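(* For $i=1,2$, let $\Gamma_i$ be a finitely generated residually finite group acting freely, cellularly, and cocompactly on a connected locally finite regular square complex $X_i$. For each $i$, use one cofinal family of finite index normal subgroups of $\Gamma_i$ to complete all five component spaces of the cubical residual complex of $X_i$, and write $\widehat X_i$ for the resulting profinite cubical residual complex. Suppose that $\eta:\widehat\Gamma_1\xrightarrow{\cong}\widehat\Gamma_2$ is a continuous group isomorphism and that $F:\widehat X_1\to\widehat X_2$ is an $\eta$-equivariant isomorphism of residual complexes, so $F$ is a tuple of five homeomorphisms commuting with all four structure maps. Then there are $u\in\widehat\Gamma_2$ and an isomorphism $h:\Gamma_1\to\Gamma_2$ such that $$\eta=\operatorname{Inn}(u)\circ\widehat h,\qquad F(X_1)=uX_2.$$ Equivalently, the normalized pair $(\operatorname{Inn}(u^{-1})\circ\eta,\ u^{-1}F)$ maps $X_1$ onto $X_2$, where $(u^{-1}F)(x)=u^{-1}F(x)$. In particular, $\eta$ is discretely induced up to profinite inner automorphism.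
   Context: A regular square complex $C$ is a two-dimensional cube complex in which every cell has a characteristic map that is a homeomorphism onto its closure: $\chi_e:[-1,1]\to\bar e$ for open edges, $\chi_q:[-1,1]^2\to\bar q$ for open squares. Its cubical residual complex is $\mathcal I(C)=(C^0,C^1,C^2,I_{10},I_{21},p_{10},q_{10},p_{21},q_{21})$, where $C^k$ is the set of open $k$-cells, $I_{10}=\{(e,\epsilon):e\in C^1,\epsilon=\pm1\}$ (endpoint occurrences), $I_{21}=\{(q,j,\epsilon):q\in C^2,j\in\{1,2\},\epsilon=\pm1\}$ (side occurrences), $p_{10}(e,\epsilon)=e$, $q_{10}(e,\epsilon)=\chi_e(\epsilon)$, $p_{21}(q,j,\epsilon)=q$, and $q_{21}(q,j,\epsilon)$ is the open edge which is the image under $\chi_q$ of the open side $\{x_j=\epsilon\}$ of $[-1,1]^2$. Cellular automorphisms act on all five sets compatibly with the four structure maps. For $\Gamma$ acting on $C$ and a family $\mathscr N$ of finite index normal subgroups that is cofinal (directed under reverse inclusion, and every finite index normal subgroup contains a member), the completion is $\varprojlim_{N\in\mathscr N}N\backslash\mathcal I(C)$, taken componentwise on the five sets (each $N\backslash Z$ finite, discrete) and the four maps; occurrence orbits are kept distinct. It carries a $\widehat\Gamma$-action; $\eta$-equivariance means $F(\gamma y)=\eta(\gamma)F(y)$. The original cells and occurrences are the points in the canonical images of the five sets of $\mathcal I(C)$ in their completions. $F(X_1)=uX_2$ means that on each of the five components $F$ maps the original subset of $\widehat X_1$ onto the left translate by $u$ of the original subset of $\widehat X_2$. $\operatorname{Inn}(u)(x)=uxu^{-1}$.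 "Discretely induced up to profinite inner automorphism" means of the form $\operatorname{Inn}(u)\circ\widehat h$ with $h$ an isomorphism of the discrete groups. *)

theory Defs
  imports "HOL-Analysis.Analysis" "HOL-Algebra.Group_Action" "HOL-Algebra.Generated_Groups"
begin

section \<open>Groups and profinite completions\<close>

definition finitely_generated :: "('g, 'b) monoid_scheme \<Rightarrow> bool" where
  "finitely_generated G \<longleftrightarrow> (\<exists>S. finite S \<and> S \<subseteq> carrier G \<and> generate G S = carrier G)"

definition finite_index_normal :: "('g, 'b) monoid_scheme \<Rightarrow> 'g set set" where
  "finite_index_normal G = {N. N \<lhd> G \<and> finite (rcosets\<^bsub>G\<^esub> N)}"

definition residually_finite :: "('g, 'b) monoid_scheme \<Rightarrow> bool" where
  "residually_finite G \<longleftrightarrow>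
     (\<forall>g\<in>carrier G. g \<noteq> \<one>\<^bsub>G\<^esub> \<longrightarrow> (\<exists>N\<in>finite_index_normal G. g \<notin> N))"

definition cofinal_family :: "('g, 'b) monoid_scheme \<Rightarrow> 'g set set \<Rightarrow> bool" where
  "cofinal_family G \<N> \<longleftrightarrow>
     \<N> \<subseteq> finite_index_normal G \<and>
     (\<forall>N\<in>\<N>. \<forall>M\<in>\<N>. \<exists>L\<in>\<N>. L \<subseteq> N \<inter> M) \<and>
     (\<forall>H\<in>finite_index_normal G. \<exists>N\<in>\<N>. N \<subseteq> H)"

text \<open>
  The profinite completion is the inverse limit of the quotients \<open>G Mod N\<close> over all finite index
  normal subgroups. Its elements are compatible threads of cosets; for \<open>N \<subseteq> M\<close> the transition map
  \<open>G Mod N \<rightarrow> G Mod M\<close> is \<open>Ng \<mapsto> M(Ng) = Mg\<close>.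
\<close>

definition profinite_top :: "('g, 'b) monoid_scheme \<Rightarrow> ('g set \<Rightarrow> 'g set) topology" where
  "profinite_top G =
     subtopology
       (product_topology (\<lambda>N. discrete_topology (carrier (G Mod N))) (finite_index_normal G))
       {x. \<forall>N\<in>finite_index_normal G. \<forall>M\<in>finite_index_normal G.
             N \<subseteq> M \<longrightarrow> x M = M <#>\<^bsub>G\<^esub> x N}"

definition profinite_group :: "('g, 'b) monoid_scheme \<Rightarrow> ('g set \<Rightarrow> 'g set) monoid" where
  "profinite_group G =
     \<lparr>carrier = topspace (profinite_top G),
      mult = (\<lambda>x y. \<lambda>N\<in>finite_index_normal G. x N \<otimes>\<^bsub>G Mod N\<^esub> y N),
      one = (\<lambda>N\<in>finite_index_normal G. \<one>\<^bsub>G Mod N\<^esub>)\<rparr>"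

text \<open>
  The map induced on profinite completions by a homomorphism \<open>h\<close>: the coordinate at \<open>M\<close> is the
  image of the coordinate at \<open>h\<inverse>(M)\<close> under \<open>G Mod h\<inverse>(M) \<rightarrow> H Mod M\<close>.
\<close>

definition profinite_map ::
  "('g, 'b) monoid_scheme \<Rightarrow> ('h, 'd) monoid_scheme \<Rightarrow> ('g \<Rightarrow> 'h)
     \<Rightarrow> ('g set \<Rightarrow> 'g set) \<Rightarrow> ('h set \<Rightarrow> 'h set)" where
  "profinite_map G H h x =
     (\<lambda>M\<in>finite_index_normal H. M <#>\<^bsub>H\<^esub> h ` x {g \<in> carrier G. h g \<in> M})"

definition Inn :: "('g, 'b) monoid_scheme \<Rightarrow> 'g \<Rightarrow> 'g \<Rightarrow> 'g" where
  "Inn G u x = u \<otimes>\<^bsub>G\<^esub> x \<otimes>\<^bsub>G\<^esub> inv\<^bsub>G\<^esub> u"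

definition discretely_induced_up_to_inner ::
  "('g, 'b) monoid_scheme \<Rightarrow> ('h, 'd) monoid_scheme
     \<Rightarrow> (('g set \<Rightarrow> 'g set) \<Rightarrow> ('h set \<Rightarrow> 'h set)) \<Rightarrow> bool" where
  "discretely_induced_up_to_inner G H \<eta> \<longleftrightarrow>
     (\<exists>u\<in>carrier (profinite_group H). \<exists>h\<in>iso G H.
        \<forall>x\<in>carrier (profinite_group G). \<eta> x = Inn (profinite_group H) u (profinite_map G H h x))"


section \<open>Regular square complexes\<close>

text \<open>
  A square complex is a topological space with a set of vertices (points), a set of open edges and
  a set of open squares (both given as subsets of the space), and characteristic maps.
\<close>

record 'p square_complex =
  realization :: "'p topology"
  verts :: "'p set"
  edges :: "'p set set"
  squares :: "'p set set"
  chi1 :: "'p set \<Rightarrow> real \<Rightarrow> 'p"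
  chi2 :: "'p set \<Rightarrow> real \<times> real \<Rightarrow> 'p"

definition cells :: "'p square_complex \<Rightarrow> 'p set set" where
  "cells C = (\<lambda>v. {v}) ` verts C \<union> edges C \<union> squares C"

definition side_point :: "nat \<Rightarrow> real \<Rightarrow> real \<Rightarrow> real \<times> real" where
  "side_point j \<epsilon> t = (if j = 1 then (\<epsilon>, t) else (t, \<epsilon>))"

definition open_side :: "nat \<Rightarrow> real \<Rightarrow> (real \<times> real) set" where
  "open_side j \<epsilon> = side_point j \<epsilon> ` {-1<..<1}"

text \<open>
  Conditions: the open cells partition a Hausdorff space; the characteristic maps are homeomorphisms
  from the closed cubes onto the closures of the cells, carrying the interior onto the open cell;
  the complex is cubical, that is, on each closed side a square restricts to the characteristic map
  of an edge up to an isometry of the interval; and the topology is the weak topology determined by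
  the closed cells. Closure finiteness follows. As usual, two-dimensional means that there are no
  cells of dimension greater than two.
\<close>

definition regular_square_complex :: "'p square_complex \<Rightarrow> bool" where
  "regular_square_complex C \<longleftrightarrow>
     (let X = realization C in
        Hausdorff_space X \<and>
        \<Union>(cells C) = topspace X \<and>
        pairwise disjnt (cells C) \<and>
        (\<forall>e\<in>edges C.
           homeomorphic_map (top_of_set {-1..1}) (subtopology X (X closure_of e)) (chi1 C e) \<and>
           chi1 C e ` {-1<..<1} = e \<and>
           chi1 C e ` {-1, 1} \<subseteq> verts C) \<and>
        (\<forall>q\<in>squares C.
           homeomorphic_map (top_of_set ({-1..1} \<times> {-1..1})) (subtopology X (X closure_of q))
             (chi2 C q) \<and>
           chi2 C q ` ({-1<..<1} \<times> {-1<..<1}) = q \<and>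
           (\<forall>j\<in>{1, 2}. \<forall>\<epsilon>\<in>{-1, 1}. \<exists>e\<in>edges C. \<exists>\<sigma>\<in>{-1, 1}. \<forall>t\<in>{-1..1}.
              chi2 C q (side_point j \<epsilon> t) = chi1 C e (\<sigma> * t))) \<and>
        (\<forall>A. A \<subseteq> topspace X \<longrightarrow>
           (\<forall>c\<in>cells C. closedin X (A \<inter> X closure_of c)) \<longrightarrow> closedin X A))"

text \<open>The empty complex is not considered connected (\<open>connected_space\<close> alone would allow it).\<close>

definition connected_complex :: "'p square_complex \<Rightarrow> bool" where
  "connected_complex C \<longleftrightarrow>
     topspace (realization C) \<noteq> {} \<and> connected_space (realization C)"

definition locally_finite_complex :: "'p square_complex \<Rightarrow> bool" where
  "locally_finite_complex C \<longleftrightarrow>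
     (\<forall>x\<in>topspace (realization C). \<exists>U. openin (realization C) U \<and> x \<in> U \<and>
        finite {c \<in> cells C. c \<inter> U \<noteq> {}})"

definition cellular_action ::
  "('g, 'b) monoid_scheme \<Rightarrow> 'p square_complex \<Rightarrow> ('g \<Rightarrow> 'p \<Rightarrow> 'p) \<Rightarrow> bool" where
  "cellular_action G C \<phi> \<longleftrightarrow>
     group_action G (topspace (realization C)) \<phi> \<and>
     (\<forall>g\<in>carrier G.
        homeomorphic_map (realization C) (realization C) (\<phi> g) \<and>
        (\<forall>v\<in>verts C. \<phi> g v \<in> verts C) \<and>
        (\<forall>e\<in>edges C. \<phi> g ` e \<in> edges C) \<and>
        (\<forall>q\<in>squares C. \<phi> g ` q \<in> squares C))"

definition free_action ::
  "('g, 'b) monoid_scheme \<Rightarrow> 'p square_complex \<Rightarrow> ('g \<Rightarrow> 'p \<Rightarrow> 'p) \<Rightarrow> bool" where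
  "free_action G C \<phi> \<longleftrightarrow>
     (\<forall>g\<in>carrier G. \<forall>x\<in>topspace (realization C). \<phi> g x = x \<longrightarrow> g = \<one>\<^bsub>G\<^esub>)"

definition cocompact_action ::
  "('g, 'b) monoid_scheme \<Rightarrow> 'p square_complex \<Rightarrow> ('g \<Rightarrow> 'p \<Rightarrow> 'p) \<Rightarrow> bool" where
  "cocompact_action G C \<phi> \<longleftrightarrow>
     (\<exists>K. compactin (realization C) K \<and> (\<Union>g\<in>carrier G. \<phi> g ` K) = topspace (realization C))"


section \<open>Residual complexes\<close>

text \<open>
  The five component sets are indexed by \<open>rsort\<close>. So that statements can be made uniformly in the
  component, all components of one residual complex have elements in one type; for the cubical
  residual complex of a square complex this is the tagged union \<open>relt\<close>.
\<close>

datatype rsort = C0 | C1 | C2 | I10 | I21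

datatype 'p relt =
    Vert 'p
  | Edge "'p set"
  | Square "'p set"
  | EndOcc "'p set" real
  | SideOcc "'p set" nat real

record 'z residual_complex =
  component :: "rsort \<Rightarrow> 'z topology"
  p10 :: "'z \<Rightarrow> 'z"
  q10 :: "'z \<Rightarrow> 'z"
  p21 :: "'z \<Rightarrow> 'z"
  q21 :: "'z \<Rightarrow> 'z"

fun cubical_set :: "'p square_complex \<Rightarrow> rsort \<Rightarrow> 'p relt set" where
  "cubical_set C C0 = Vert ` verts C"
| "cubical_set C C1 = Edge ` edges C"
| "cubical_set C C2 = Square ` squares C"
| "cubical_set C I10 = {EndOcc e \<epsilon> | e \<epsilon>. e \<in> edges C \<and> \<epsilon> \<in> {-1, 1}}"
| "cubical_set C I21 = {SideOcc q j \<epsilon> | q j \<epsilon>. q \<in> squares C \<and> j \<in> {1, 2} \<and> \<epsilon> \<in> {-1, 1}}"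

fun cubical_p10 :: "'p relt \<Rightarrow> 'p relt" where
  "cubical_p10 (EndOcc e \<epsilon>) = Edge e"

fun cubical_q10 :: "'p square_complex \<Rightarrow> 'p relt \<Rightarrow> 'p relt" where
  "cubical_q10 C (EndOcc e \<epsilon>) = Vert (chi1 C e \<epsilon>)"

fun cubical_p21 :: "'p relt \<Rightarrow> 'p relt" where
  "cubical_p21 (SideOcc q j \<epsilon>) = Square q"

fun cubical_q21 :: "'p square_complex \<Rightarrow> 'p relt \<Rightarrow> 'p relt" where
  "cubical_q21 C (SideOcc q j \<epsilon>) = Edge (chi2 C q ` open_side j \<epsilon>)"

definition cubical_residual_complex :: "'p square_complex \<Rightarrow> 'p relt residual_complex" where
  "cubical_residual_complex C =
     \<lparr>component = (\<lambda>k. discrete_topology (cubical_set C k)),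
      p10 = cubical_p10, q10 = cubical_q10 C, p21 = cubical_p21, q21 = cubical_q21 C\<rparr>"

text \<open>
  A cellular automorphism moves an occurrence to the occurrence in the image cell at the image
  endpoint or side; since the characteristic maps are injective, the latter is unique.
\<close>

fun cubical_act ::
  "'p square_complex \<Rightarrow> ('g \<Rightarrow> 'p \<Rightarrow> 'p) \<Rightarrow> 'g \<Rightarrow> 'p relt \<Rightarrow> 'p relt" where
  "cubical_act C \<phi> g (Vert v) = Vert (\<phi> g v)"
| "cubical_act C \<phi> g (Edge e) = Edge (\<phi> g ` e)"
| "cubical_act C \<phi> g (Square q) = Square (\<phi> g ` q)"
| "cubical_act C \<phi> g (EndOcc e \<epsilon>) =
     EndOcc (\<phi> g ` e) (THE \<epsilon>'. \<epsilon>' \<in> {-1, 1} \<and> chi1 C (\<phi> g ` e) \<epsilon>' = \<phi> g (chi1 C e \<epsilon>))"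
| "cubical_act C \<phi> g (SideOcc q j \<epsilon>) =
     (case (THE (j', \<epsilon>'). j' \<in> {1, 2} \<and> \<epsilon>' \<in> {-1, 1} \<and>
              chi2 C (\<phi> g ` q) ` open_side j' \<epsilon>' = \<phi> g ` chi2 C q ` open_side j \<epsilon>)
      of (j', \<epsilon>') \<Rightarrow> SideOcc (\<phi> g ` q) j' \<epsilon>')"


section \<open>Completion of residual complexes\<close>

text \<open>
  For a group \<open>G\<close> acting on a set \<open>Z\<close> by \<open>a\<close>, the completion is the inverse limit of the discrete
  orbit sets \<open>N\Z\<close> over \<open>N \<in> \<N>\<close>, the transition maps being \<open>Nz \<mapsto> M(Nz) = Mz\<close> for \<open>N \<subseteq> M\<close>.
\<close>

definition completion ::
  "('g, 'b) monoid_scheme \<Rightarrow> 'g set set \<Rightarrow> ('g \<Rightarrow> 'z \<Rightarrow> 'z) \<Rightarrow> 'z set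
     \<Rightarrow> ('g set \<Rightarrow> 'z set) topology" where
  "completion G \<N> a Z =
     subtopology
       (product_topology (\<lambda>N. discrete_topology (orbits (G\<lparr>carrier := N\<rparr>) Z a)) \<N>)
       {x. \<forall>N\<in>\<N>. \<forall>M\<in>\<N>. N \<subseteq> M \<longrightarrow> x M = (\<Union>m\<in>M. a m ` x N)}"

definition completion_map ::
  "'g set set \<Rightarrow> ('z \<Rightarrow> 'w) \<Rightarrow> ('g set \<Rightarrow> 'z set) \<Rightarrow> ('g set \<Rightarrow> 'w set)" where
  "completion_map \<N> f x = (\<lambda>N\<in>\<N>. f ` x N)"

definition completion_point ::
  "('g, 'b) monoid_scheme \<Rightarrow> 'g set set \<Rightarrow> ('g \<Rightarrow> 'z \<Rightarrow> 'z) \<Rightarrow> 'z \<Rightarrow> ('g set \<Rightarrow> 'z set)" where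
  "completion_point G \<N> a z = (\<lambda>N\<in>\<N>. orbit (G\<lparr>carrier := N\<rparr>) a z)"

text \<open>
  An element \<open>u\<close> of the profinite group acts on the coordinate at \<open>N\<close> through its coset
  \<open>u N \<in> G Mod N\<close>, by \<open>Ng \<cdot> Nz = Ngz\<close>.
\<close>

definition completion_act ::
  "'g set set \<Rightarrow> ('g \<Rightarrow> 'z \<Rightarrow> 'z) \<Rightarrow> ('g set \<Rightarrow> 'g set)
     \<Rightarrow> ('g set \<Rightarrow> 'z set) \<Rightarrow> ('g set \<Rightarrow> 'z set)" where
  "completion_act \<N> a u x = (\<lambda>N\<in>\<N>. \<Union>g\<in>u N. a g ` x N)"

definition completed_residual_complex ::
  "('g, 'b) monoid_scheme \<Rightarrow> 'g set set \<Rightarrow> 'p square_complex \<Rightarrow> ('g \<Rightarrow> 'p \<Rightarrow> 'p)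
     \<Rightarrow> ('g set \<Rightarrow> 'p relt set) residual_complex" where
  "completed_residual_complex G \<N> C \<phi> =
     (let R = cubical_residual_complex C in
      \<lparr>component = (\<lambda>k. completion G \<N> (cubical_act C \<phi>) (topspace (component R k))),
       p10 = completion_map \<N> (p10 R), q10 = completion_map \<N> (q10 R),
       p21 = completion_map \<N> (p21 R), q21 = completion_map \<N> (q21 R)\<rparr>)"

definition original_points ::
  "('g, 'b) monoid_scheme \<Rightarrow> 'g set set \<Rightarrow> 'p square_complex \<Rightarrow> ('g \<Rightarrow> 'p \<Rightarrow> 'p) \<Rightarrow> rsort
     \<Rightarrow> ('g set \<Rightarrow> 'p relt set) set" where
  "original_points G \<N> C \<phi> k =
     completion_point G \<N> (cubical_act C \<phi>) ` topspace (component (cubical_residual_complex C) k)"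

definition residual_isomorphism ::
  "'z residual_complex \<Rightarrow> 'w residual_complex \<Rightarrow> (rsort \<Rightarrow> 'z \<Rightarrow> 'w) \<Rightarrow> bool" where
  "residual_isomorphism A B F \<longleftrightarrow>
     (\<forall>k. homeomorphic_map (component A k) (component B k) (F k)) \<and>
     (\<forall>y\<in>topspace (component A I10).
        F C1 (p10 A y) = p10 B (F I10 y) \<and> F C0 (q10 A y) = q10 B (F I10 y)) \<and>
     (\<forall>y\<in>topspace (component A I21).
        F C2 (p21 A y) = p21 B (F I21 y) \<and> F C1 (q21 A y) = q21 B (F I21 y))"

end

theory Submission
  imports Defs
begin

text \<open>
  By Brouwer's theorem a cellular automorphism fixing an open cell setwise has a fixed point in the
  closed cell, so the actions on cells and occurrences are free. Hence every point of a completed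
  component is a profinite translate of an original point, and two original points are translates
  of each other only by elements of the discrete group. It follows that an occurrence lies in a
  translate \<open>uX\<close> if and only if its cell does, and if and only if its endpoint or side does. Since
  \<open>X\<close> is connected, the translates \<open>uX\<close> are therefore the combinatorial components of the
  completion, so that \<open>F\<close> maps \<open>X1\<close> onto some \<open>uX2\<close>, and \<open>Inn(u\<inverse>) \<circ> \<eta>\<close> maps \<open>\<Gamma>1\<close>, the setwise
  stabilizer of \<open>X1\<close>, onto \<open>\<Gamma>2\<close>. As \<open>\<Gamma>1\<close> is dense, this determines \<open>\<eta>\<close>.
\<close>

section \<open>The profinite completion as a group\<close>

text \<open>Freeness on cells turns orbits into cosets. The orbit map of a cell is injective on the
  group, so a thread of orbits over one cell can be divided by that cell, which leaves a thread of
  cosets, that is, an element of the profinite group. Division also compares translates: if an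
  equivariant map sends \<open>v z\<close> to \<open>u w\<close> with \<open>z\<close> and
  \<open>w\<close> original, then \<open>v\<close> and \<open>u\<close> differ on the right by a
  discrete element, so \<open>v z\<close> already belongs to the translate by \<open>u\<close>.

  The element \<open>u\<close> arises by writing the image of one original vertex as
  \<open>u w\<close>; any other way of writing it changes \<open>u\<close> by an element of
  \<Gamma>2 on the right. From that vertex the structure maps give only one inclusion between
  \<open>F(X1)\<close> and \<open>u X2\<close>. For the other one the same argument is run for the
  inverse of \<open>F\<close>, and equivariance turns the translate found there back into
  \<open>u\<close>. The second inclusion is what makes \<Gamma>1 map onto \<Gamma>2 and not only
  into it.\<close>

context group
begin

lemma finite_index_normal_normal: "N \<in> finite_index_normal G \<Longrightarrow> N \<lhd> G"
  by (simp add: finite_index_normal_def)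

lemma finite_index_normal_subgroup: "N \<in> finite_index_normal G \<Longrightarrow> subgroup N G"
  using finite_index_normal_normal normal_imp_subgroup by blast

text \<open>A cofinal family is nonempty because it has a member below this subgroup;
  \<open>family_cofinal\<close> is applied to it whenever some coordinate is wanted.\<close>

lemma carrier_finite_index_normal: "carrier G \<in> finite_index_normal G"
proof -
  have "rcosets (carrier G) \<subseteq> {carrier G}"
    by (auto simp: RCOSETS_def coset_join2 subgroup_self)
  then have "finite (rcosets (carrier G))"
    using finite_subset by blast
  moreover have "carrier G \<lhd> G"
    by (simp add: normal_inv_iff subgroup_self)
  ultimately show ?thesis by (simp add: finite_index_normal_def)
qed

text \<open>\<open>M N = M\<close>, since \<open>N\<close> contains the unit and lies in
  \<open>M\<close>. Thus the transition map of the inverse system sends the coset of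
  \<open>g\<close> at \<open>N\<close> to the coset of the same \<open>g\<close> at
  \<open>M\<close>.\<close>

lemma set_mult_r_coset_subgroup:
  assumes "subgroup N G" "subgroup M G" "N \<subseteq> M" "g \<in> carrier G"
  shows "M <#> (N #> g) = M #> g"
proof -
  have "M <#> N = M"
  proof
    show "M <#> N \<subseteq> M"
      using assms subgroup.m_closed[OF assms(2)] by (auto simp: set_mult_def)
    show "M \<subseteq> M <#> N"
    proof
      fix m assume "m \<in> M"
      then have "m = m \<otimes> \<one>" using assms(2) subgroup.mem_carrier by fastforce
      moreover have "\<one> \<in> N" using assms(1) subgroup.one_closed by blast
      ultimately show "m \<in> M <#> N" using \<open>m \<in> M\<close> unfolding set_mult_def by blast
    qed
  qed
  then show ?thesis
    using assms by (simp add: setmult_rcos_assoc subgroup.subset)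
qed

lemma r_coset_eq_mono:
  assumes "subgroup N G" "subgroup M G" "N \<subseteq> M" "g \<in> carrier G" "h \<in> carrier G"
    and "N #> g = N #> h"
  shows "M #> g = M #> h"
  using assms set_mult_r_coset_subgroup by metis

text \<open>Along a comparable pair one representative serves both coordinates, by
  \<open>set_mult_r_coset_subgroup\<close>; the pair \<open>N = M\<close> recovers that every
  coordinate is a coset. Closure under the group operations can then be checked on
  representatives.\<close>

lemma profinite_carrier_iff:
  "u \<in> carrier (profinite_group G) \<longleftrightarrow>
     u \<in> extensional (finite_index_normal G) \<and>
     (\<forall>N\<in>finite_index_normal G. \<forall>M\<in>finite_index_normal G. N \<subseteq> M \<longrightarrow>
        (\<exists>g\<in>carrier G. u N = N #> g \<and> u M = M #> g))" (is "?L \<longleftrightarrow> ?R")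
proof -
  let ?F = "finite_index_normal G"
  have L: "?L \<longleftrightarrow> u \<in> extensional ?F \<and> (\<forall>N\<in>?F. u N \<in> rcosets N) \<and>
     (\<forall>N\<in>?F. \<forall>M\<in>?F. N \<subseteq> M \<longrightarrow> u M = M <#> u N)"
    by (auto simp: profinite_group_def profinite_top_def FactGroup_def PiE_iff)
  show ?thesis
  proof
    assume ?L
    then have ext: "u \<in> extensional ?F" and cos: "\<And>N. N \<in> ?F \<Longrightarrow> u N \<in> rcosets N"
      and comp: "\<And>N M. N \<in> ?F \<Longrightarrow> M \<in> ?F \<Longrightarrow> N \<subseteq> M \<Longrightarrow> u M = M <#> u N"
      unfolding L by blast+
    show ?R
    proof (intro conjI ballI impI)
      show "u \<in> extensional ?F" by (fact ext)
      fix N M assume NM: "N \<in> ?F" "M \<in> ?F" "N \<subseteq> M"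
      obtain g where g: "g \<in> carrier G" "u N = N #> g"
        using cos[OF NM(1)] by (auto simp: RCOSETS_def)
      then have "u M = M #> g"
        using NM by (simp add: comp[OF NM] set_mult_r_coset_subgroup finite_index_normal_subgroup)
      then show "\<exists>g\<in>carrier G. u N = N #> g \<and> u M = M #> g" using g by blast
    qed
  next
    assume R: ?R
    have 1: "u N \<in> rcosets N" if "N \<in> ?F" for N
      using R that by (fastforce simp: RCOSETS_def)
    have 2: "u M = M <#> u N" if NM: "N \<in> ?F" "M \<in> ?F" "N \<subseteq> M" for N M
    proof -
      obtain g where "g \<in> carrier G" "u N = N #> g" "u M = M #> g" using R NM by blast
      then show ?thesis
        using NM by (simp add: set_mult_r_coset_subgroup finite_index_normal_subgroup)
    qed
    show ?L unfolding L by (intro conjI ballI impI 1 2) (use R in auto)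
  qed
qed

lemma profinite_coset:
  assumes "u \<in> carrier (profinite_group G)" "N \<in> finite_index_normal G"
  obtains g where "g \<in> carrier G" "u N = N #> g"
  using assms profinite_carrier_iff by blast

lemma profinite_coset_subset:
  assumes "u \<in> carrier (profinite_group G)" "N \<in> finite_index_normal G"
  shows "u N \<subseteq> carrier G"
  using assms profinite_coset finite_index_normal_subgroup r_coset_subset_G subgroup.subset by metis

lemma profinite_coset_nonempty:
  assumes "u \<in> carrier (profinite_group G)" "N \<in> finite_index_normal G"
  shows "u N \<noteq> {}"
  using assms profinite_coset finite_index_normal_subgroup rcos_self by (metis empty_iff)

lemma profinite_mult:
  "N \<in> finite_index_normal G \<Longrightarrow> (u \<otimes>\<^bsub>profinite_group G\<^esub> v) N = u N <#> v N"
  by (simp add: profinite_group_def)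

lemma profinite_one: "N \<in> finite_index_normal G \<Longrightarrow> \<one>\<^bsub>profinite_group G\<^esub> N = N"
  by (simp add: profinite_group_def)

lemma profinite_ext:
  assumes "u \<in> carrier (profinite_group G)" "v \<in> carrier (profinite_group G)"
    and "\<And>N. N \<in> finite_index_normal G \<Longrightarrow> u N = v N"
  shows "u = v"
  using assms extensionalityI profinite_carrier_iff by blast

lemma profinite_mult_coset:
  assumes "N \<in> finite_index_normal G" "g \<in> carrier G" "h \<in> carrier G" "u N = N #> g" "v N = N #> h"
  shows "(u \<otimes>\<^bsub>profinite_group G\<^esub> v) N = N #> (g \<otimes> h)"
  using assms normal.rcos_sum[OF finite_index_normal_normal] by (simp add: profinite_mult)

lemma profinite_mult_closed:
  assumes u: "u \<in> carrier (profinite_group G)" and v: "v \<in> carrier (profinite_group G)"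
  shows "u \<otimes>\<^bsub>profinite_group G\<^esub> v \<in> carrier (profinite_group G)"
  unfolding profinite_carrier_iff
proof (intro conjI ballI impI)
  show "u \<otimes>\<^bsub>profinite_group G\<^esub> v \<in> extensional (finite_index_normal G)"
    by (simp add: profinite_group_def)
  fix N M assume NM: "N \<in> finite_index_normal G" "M \<in> finite_index_normal G" "N \<subseteq> M"
  obtain g where "g \<in> carrier G" "u N = N #> g" "u M = M #> g"
    using u NM unfolding profinite_carrier_iff by blast
  moreover obtain h where "h \<in> carrier G" "v N = N #> h" "v M = M #> h"
    using v NM unfolding profinite_carrier_iff by blast
  ultimately show "\<exists>g\<in>carrier G. (u \<otimes>\<^bsub>profinite_group G\<^esub> v) N = N #> g \<and>
      (u \<otimes>\<^bsub>profinite_group G\<^esub> v) M = M #> g"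
    using NM profinite_mult_coset m_closed by meson
qed

definition profinite_embed :: "'a \<Rightarrow> 'a set \<Rightarrow> 'a set" where
  "profinite_embed g = (\<lambda>N\<in>finite_index_normal G. N #> g)"

lemma profinite_embed_closed:
  "g \<in> carrier G \<Longrightarrow> profinite_embed g \<in> carrier (profinite_group G)"
  unfolding profinite_carrier_iff by (auto simp: profinite_embed_def)

lemma profinite_one_embed: "\<one>\<^bsub>profinite_group G\<^esub> = profinite_embed \<one>"
  by (auto simp: profinite_embed_def profinite_group_def finite_index_normal_subgroup subgroup.subset
      intro!: restrict_ext)

lemma profinite_embed_mult:
  assumes "g \<in> carrier G" "h \<in> carrier G"
  shows "profinite_embed (g \<otimes> h) = profinite_embed g \<otimes>\<^bsub>profinite_group G\<^esub> profinite_embed h"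
  using assms by (intro profinite_ext profinite_mult_closed profinite_embed_closed m_closed)
    (auto simp: profinite_mult_coset profinite_embed_def)

lemma group_profinite: "group (profinite_group G)"
proof (rule groupI)
  let ?P = "profinite_group G" and ?F = "finite_index_normal G"
  show "\<one>\<^bsub>?P\<^esub> \<in> carrier ?P" by (simp add: profinite_one_embed profinite_embed_closed)
  show "x \<otimes>\<^bsub>?P\<^esub> y \<in> carrier ?P" if "x \<in> carrier ?P" "y \<in> carrier ?P" for x y
    using that by (rule profinite_mult_closed)
  show "x \<otimes>\<^bsub>?P\<^esub> y \<otimes>\<^bsub>?P\<^esub> z = x \<otimes>\<^bsub>?P\<^esub> (y \<otimes>\<^bsub>?P\<^esub> z)"
    if "x \<in> carrier ?P" "y \<in> carrier ?P" "z \<in> carrier ?P" for x y z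
    using that by (intro profinite_ext profinite_mult_closed)
      (simp_all add: profinite_mult set_mult_assoc profinite_coset_subset)
  show "\<one>\<^bsub>?P\<^esub> \<otimes>\<^bsub>?P\<^esub> x = x" if x: "x \<in> carrier ?P" for x
  proof (rule profinite_ext)
    fix N assume N: "N \<in> ?F"
    obtain g where "g \<in> carrier G" "x N = N #> g" using profinite_coset x N by blast
    then show "(\<one>\<^bsub>?P\<^esub> \<otimes>\<^bsub>?P\<^esub> x) N = x N"
      using N by (simp add: profinite_mult profinite_one set_mult_r_coset_subgroup finite_index_normal_subgroup)
  qed (use x in \<open>auto simp: profinite_one_embed profinite_embed_closed profinite_mult_closed\<close>)
  show "\<exists>y\<in>carrier ?P. y \<otimes>\<^bsub>?P\<^esub> x = \<one>\<^bsub>?P\<^esub>" if x: "x \<in> carrier ?P" for x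
  proof
    define y where "y = (\<lambda>N\<in>?F. set_inv (x N))"
    have y: "y N = N #> inv g" if "N \<in> ?F" "g \<in> carrier G" "x N = N #> g" for N g
      using that by (simp add: y_def normal.rcos_inv finite_index_normal_normal)
    show yc: "y \<in> carrier ?P"
      unfolding profinite_carrier_iff
    proof (intro conjI ballI impI)
      show "y \<in> extensional ?F" by (simp add: y_def)
      fix N M assume NM: "N \<in> ?F" "M \<in> ?F" "N \<subseteq> M"
      then obtain g where "g \<in> carrier G" "x N = N #> g" "x M = M #> g"
        using x unfolding profinite_carrier_iff by blast
      then show "\<exists>g\<in>carrier G. y N = N #> g \<and> y M = M #> g"
        using y NM inv_closed by blast
    qed
    show "y \<otimes>\<^bsub>?P\<^esub> x = \<one>\<^bsub>?P\<^esub>"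
    proof (rule profinite_ext)
      fix N assume N: "N \<in> ?F"
      obtain g where g: "g \<in> carrier G" "x N = N #> g" using profinite_coset x N by blast
      have "(y \<otimes>\<^bsub>?P\<^esub> x) N = N #> (inv g \<otimes> g)"
        using N g y by (intro profinite_mult_coset) auto
      then show "(y \<otimes>\<^bsub>?P\<^esub> x) N = \<one>\<^bsub>?P\<^esub> N"
        using N g by (simp add: profinite_one finite_index_normal_subgroup subgroup.subset)
    qed (use x yc in \<open>auto simp: profinite_one_embed profinite_embed_closed profinite_mult_closed\<close>)
  qed
qed

text \<open>Equal threads put \<open>g h^-1\<close> into every finite index normal subgroup, which
  residual finiteness allows only for the unit. Identities between threads can thereby be read back
  in the discrete group.\<close>

lemma profinite_embed_inj:
  assumes "residually_finite G"
  shows "inj_on profinite_embed (carrier G)"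
proof (rule inj_onI)
  fix g h assume gh: "g \<in> carrier G" "h \<in> carrier G" "profinite_embed g = profinite_embed h"
  show "g = h"
  proof (rule ccontr)
    assume "g \<noteq> h"
    then have "g \<otimes> inv h \<noteq> \<one>" using gh inv_equality inv_inv by fastforce
    then obtain N where N: "N \<in> finite_index_normal G" "g \<otimes> inv h \<notin> N"
      using assms gh unfolding residually_finite_def by blast
    have "N #> g = N #> h"
      using fun_cong[OF gh(3), of N] N(1) by (simp add: profinite_embed_def)
    moreover have s: "subgroup N G" using N(1) by (rule finite_index_normal_subgroup)
    ultimately have "g \<in> N #> h" using gh rcos_self by blast
    then show False
      using subgroup.rcos_module_imp[OF s is_group] gh N(2) by blast
  qed
qed

end


section \<open>Completions along a cofinal family\<close>

locale cofinal_group = group G for G :: "('g, 'b) monoid_scheme" (structure) +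
  fixes \<N> :: "'g set set"
  assumes cofinal: "cofinal_family G \<N>"
begin

lemma family_finite_index: "N \<in> \<N> \<Longrightarrow> N \<in> finite_index_normal G"
  using cofinal unfolding cofinal_family_def by blast

lemma family_directed:
  assumes "N \<in> \<N>" "M \<in> \<N>"
  obtains L where "L \<in> \<N>" "L \<subseteq> N" "L \<subseteq> M"
  using cofinal assms unfolding cofinal_family_def by blast

lemma family_cofinal:
  assumes "H \<in> finite_index_normal G"
  obtains N where "N \<in> \<N>" "N \<subseteq> H"
  using cofinal assms unfolding cofinal_family_def by blast

text \<open>The coordinate at any \<open>H\<close> is the image of the coordinate at a member of the
  family below \<open>H\<close>, so agreement on the family passes upwards.\<close>

lemma profinite_ext_family:
  assumes u: "u \<in> carrier (profinite_group G)" and v: "v \<in> carrier (profinite_group G)"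
    and eq: "\<And>N. N \<in> \<N> \<Longrightarrow> u N = v N"
  shows "u = v"
proof (rule profinite_ext[OF u v])
  fix H assume H: "H \<in> finite_index_normal G"
  then obtain N where N: "N \<in> \<N>" "N \<subseteq> H" using family_cofinal by blast
  obtain g where g: "g \<in> carrier G" "u N = N #> g" "u H = H #> g"
    using u N H family_finite_index unfolding profinite_carrier_iff by blast
  obtain h where h: "h \<in> carrier G" "v N = N #> h" "v H = H #> h"
    using v N H family_finite_index unfolding profinite_carrier_iff by blast
  have "H #> g = H #> h"
    using r_coset_eq_mono[of N H g h] N H g h eq[OF N(1)]
    by (auto simp: finite_index_normal_subgroup family_finite_index)
  then show "u H = v H" using g h by simp
qed

lemma family_lower_bound:
  assumes "finite S" "S \<subseteq> finite_index_normal G"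
  shows "\<exists>L\<in>\<N>. \<forall>N\<in>S. L \<subseteq> N"
  using assms
proof (induction S)
  case empty
  then show ?case using family_cofinal[OF carrier_finite_index_normal] by auto
next
  case (insert H S)
  then obtain L where L: "L \<in> \<N>" "\<forall>N\<in>S. L \<subseteq> N" by auto
  obtain N where N: "N \<in> \<N>" "N \<subseteq> H" using insert.prems family_cofinal by auto
  obtain K where "K \<in> \<N>" "K \<subseteq> L" "K \<subseteq> N" using family_directed L N by blast
  then show ?case using L N by (metis insert_iff order_trans)
qed

text \<open>A basic open set restricts only finitely many coordinates. A representative of
  \<open>x\<close> at a member \<open>L\<close> below all of them also represents \<open>x\<close>
  at each of them, so its thread lies in the set.\<close>

lemma profinite_embed_dense:
  assumes U: "openin (profinite_top G) U" and x: "x \<in> U"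
  shows "\<exists>g\<in>carrier G. profinite_embed g \<in> U"
proof -
  let ?F = "finite_index_normal G"
  let ?T = "\<lambda>N. discrete_topology (carrier (G Mod N))"
  obtain V where V: "openin (product_topology ?T ?F) V"
    and UV: "U = V \<inter> {x. \<forall>N\<in>?F. \<forall>M\<in>?F. N \<subseteq> M \<longrightarrow> x M = M <#> x N}"
    using U unfolding profinite_top_def openin_subtopology by blast
  obtain X where X: "x \<in> (\<Pi>\<^sub>E i\<in>?F. X i)" "finite {i. X i \<noteq> topspace (?T i)}" "(\<Pi>\<^sub>E i\<in>?F. X i) \<subseteq> V"
    using product_topology_open_contains_basis[OF V, of x] x UV by blast
  have xP: "x \<in> carrier (profinite_group G)"
    using openin_subset[OF U] x by (auto simp: profinite_group_def)
  obtain L where L: "L \<in> \<N>" "\<And>N. N \<in> ?F \<Longrightarrow> X N \<noteq> topspace (?T N) \<Longrightarrow> L \<subseteq> N"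
    using family_lower_bound[of "{i. X i \<noteq> topspace (?T i)} \<inter> ?F"] X(2) by auto
  obtain g where g: "g \<in> carrier G" "x L = L #> g"
    using profinite_coset xP L family_finite_index by blast
  have "profinite_embed g N \<in> X N" if N: "N \<in> ?F" for N
  proof (cases "X N = topspace (?T N)")
    case True
    then show ?thesis using N g by (auto simp: profinite_embed_def carrier_FactGroup)
  next
    case False
    then have LN: "L \<subseteq> N" using L N by blast
    obtain h where h: "h \<in> carrier G" "x L = L #> h" "x N = N #> h"
      using xP LN N family_finite_index[OF L(1)] unfolding profinite_carrier_iff by blast
    have "N #> g = N #> h"
      using r_coset_eq_mono[of L N g h] g h LN N family_finite_index[OF L(1)]
      by (auto simp: finite_index_normal_subgroup)
    then show ?thesis using X(1) N h by (auto simp: profinite_embed_def PiE_iff)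
  qed
  then have "profinite_embed g \<in> (\<Pi>\<^sub>E i\<in>?F. X i)" by (auto simp: profinite_embed_def)
  moreover have "profinite_embed g \<in> topspace (profinite_top G)"
    using profinite_embed_closed[OF g(1)] by (simp add: profinite_group_def)
  ultimately show ?thesis
    using X(3) UV g(1) by (auto simp: profinite_top_def)
qed

end


section \<open>Completion of a free action on a set\<close>

locale free_set_action = cofinal_group G \<N> for G :: "('g, 'b) monoid_scheme" (structure) and \<N> +
  fixes a :: "'g \<Rightarrow> 'z \<Rightarrow> 'z" and Z :: "'z set"
  assumes act_closed: "\<And>g z. g \<in> carrier G \<Longrightarrow> z \<in> Z \<Longrightarrow> a g z \<in> Z"
    and act_one: "\<And>z. z \<in> Z \<Longrightarrow> a \<one> z = z"
    and act_mult: "\<And>g h z. g \<in> carrier G \<Longrightarrow> h \<in> carrier G \<Longrightarrow> z \<in> Z \<Longrightarrow> a (g \<otimes> h) z = a g (a h z)"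
    and act_free: "\<And>g z. g \<in> carrier G \<Longrightarrow> z \<in> Z \<Longrightarrow> a g z = z \<Longrightarrow> g = \<one>"
begin

abbreviation completed :: "('g set \<Rightarrow> 'z set) set" where
  "completed \<equiv> topspace (completion G \<N> a Z)"

abbreviation point :: "'z \<Rightarrow> 'g set \<Rightarrow> 'z set" where
  "point \<equiv> completion_point G \<N> a"

abbreviation move :: "('g set \<Rightarrow> 'g set) \<Rightarrow> ('g set \<Rightarrow> 'z set) \<Rightarrow> ('g set \<Rightarrow> 'z set)" where
  "move \<equiv> completion_act \<N> a"

lemma orbit_subgroup: "orbit (G\<lparr>carrier := N\<rparr>) a z = (\<lambda>g. a g z) ` N"
  by (auto simp: orbit_def)

lemma act_inj:
  assumes "z \<in> Z"
  shows "inj_on (\<lambda>g. a g z) (carrier G)"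
proof (rule inj_onI)
  fix g h assume gh: "g \<in> carrier G" "h \<in> carrier G" "a g z = a h z"
  have "a (inv h \<otimes> g) z = a (inv h) (a h z)" using gh assms by (simp add: act_mult)
  also have "\<dots> = a (inv h \<otimes> h) z" using gh assms by (simp only: act_mult inv_closed)
  also have "\<dots> = z" using gh assms by (simp add: act_one)
  finally have "inv h \<otimes> g = \<one>" using gh assms act_free by simp
  then show "g = h" using gh by (metis inv_closed inv_equality inv_inv)
qed

text \<open>A set of group elements is recovered from the points it produces out of
  \<open>z\<close>, because the orbit map is injective. This is the passage from equal orbits to
  equal cosets.\<close>

lemma orbit_image_eq_iff:
  assumes "z \<in> Z" "A \<subseteq> carrier G" "B \<subseteq> carrier G"
  shows "(\<lambda>g. a g z) ` A = (\<lambda>g. a g z) ` B \<longleftrightarrow> A = B"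
  using assms act_inj inj_on_image_eq_iff by metis

lemma act_image_set_mult:
  assumes "z \<in> Z" "A \<subseteq> carrier G" "B \<subseteq> carrier G"
  shows "(\<Union>g\<in>A. a g ` (\<lambda>h. a h z) ` B) = (\<lambda>g. a g z) ` (A <#> B)"
proof -
  have "a g (a h z) = a (g \<otimes> h) z" if "g \<in> A" "h \<in> B" for g h
    using that assms act_mult by (metis subsetD)
  then show ?thesis unfolding set_mult_def by (auto 4 4 simp: image_iff)
qed

lemma orbit_translate:
  assumes "z \<in> Z" "A \<subseteq> carrier G" "g \<in> carrier G"
  shows "(\<lambda>h. a h (a g z)) ` A = (\<lambda>h. a h z) ` (A #> g)"
proof -
  have "a h (a g z) = a (h \<otimes> g) z" if "h \<in> A" for h
    using that assms act_mult by (metis subsetD)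
  then show ?thesis by (auto simp: r_coset_def image_iff)
qed

text \<open>The analogue of \<open>profinite_carrier_iff\<close>: over a comparable pair one point
  represents both orbits. The transition map takes the \<open>N\<close>-orbit of \<open>z\<close> to
  its \<open>M\<close>-orbit because \<open>M N = M\<close>.\<close>

lemma completed_iff:
  "x \<in> completed \<longleftrightarrow> x \<in> extensional \<N> \<and>
     (\<forall>N\<in>\<N>. \<forall>M\<in>\<N>. N \<subseteq> M \<longrightarrow>
        (\<exists>z\<in>Z. x N = (\<lambda>g. a g z) ` N \<and> x M = (\<lambda>g. a g z) ` M))" (is "?L \<longleftrightarrow> ?R")
proof -
  have L: "?L \<longleftrightarrow> x \<in> extensional \<N> \<and> (\<forall>N\<in>\<N>. \<exists>z\<in>Z. x N = (\<lambda>g. a g z) ` N) \<and>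
     (\<forall>N\<in>\<N>. \<forall>M\<in>\<N>. N \<subseteq> M \<longrightarrow> x M = (\<Union>m\<in>M. a m ` x N))"
  proof -
    have "?L \<longleftrightarrow> x \<in> (\<Pi>\<^sub>E N\<in>\<N>. orbits (G\<lparr>carrier := N\<rparr>) Z a) \<and>
        (\<forall>N\<in>\<N>. \<forall>M\<in>\<N>. N \<subseteq> M \<longrightarrow> x M = (\<Union>m\<in>M. a m ` x N))"
      by (simp add: completion_def)
    moreover have "y \<in> orbits (G\<lparr>carrier := N\<rparr>) Z a \<longleftrightarrow> (\<exists>z\<in>Z. y = (\<lambda>g. a g z) ` N)" for y N
      unfolding orbits_def orbit_subgroup by blast
    ultimately show ?thesis by (simp only: PiE_iff conj_ac)
  qed
  have key: "(\<Union>m\<in>M. a m ` (\<lambda>g. a g z) ` N) = (\<lambda>g. a g z) ` M"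
    if "N \<in> \<N>" "M \<in> \<N>" "N \<subseteq> M" "z \<in> Z" for N M z
  proof -
    have s: "subgroup N G" "subgroup M G"
      using that family_finite_index finite_index_normal_subgroup by blast+
    have "M <#> N = M"
      using set_mult_r_coset_subgroup[OF s that(3) one_closed] s by (simp add: subgroup.subset)
    then show ?thesis using act_image_set_mult[of z M N] s that by (simp add: subgroup.subset)
  qed
  show ?thesis
  proof
    assume l: ?L
    note ext = conjunct1[OF l[unfolded L]]
    note cos = conjunct1[OF conjunct2[OF l[unfolded L]], rule_format]
    note comp = conjunct2[OF conjunct2[OF l[unfolded L]], rule_format]
    show ?R
    proof (intro conjI ballI impI)
      show "x \<in> extensional \<N>" by (fact ext)
      fix N M assume NM: "N \<in> \<N>" "M \<in> \<N>" "N \<subseteq> M"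
      obtain z where z: "z \<in> Z" "x N = (\<lambda>g. a g z) ` N"
        using cos[OF NM(1)] by blast
      moreover have "x M = (\<lambda>g. a g z) ` M"
        using comp[OF NM] key[OF NM z(1)] z(2) by simp
      ultimately show "\<exists>z\<in>Z. x N = (\<lambda>g. a g z) ` N \<and> x M = (\<lambda>g. a g z) ` M" by blast
    qed
  next
    assume R: ?R
    note rep = conjunct2[OF R, rule_format]
    have comp: "x M = (\<Union>m\<in>M. a m ` x N)" if NM: "N \<in> \<N>" "M \<in> \<N>" "N \<subseteq> M" for N M
    proof -
      obtain z where "z \<in> Z" "x N = (\<lambda>g. a g z) ` N" "x M = (\<lambda>g. a g z) ` M"
        using rep[OF NM] by blast
      then show ?thesis using key[OF NM] by simp
    qed
    have "\<exists>z\<in>Z. x N = (\<lambda>g. a g z) ` N" if "N \<in> \<N>" for N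
      using rep[OF that that order_refl] by blast
    with comp show ?L unfolding L using conjunct1[OF R] by (intro conjI ballI impI)
  qed
qed

lemma completed_coset:
  assumes "x \<in> completed" "N \<in> \<N>" "M \<in> \<N>" "N \<subseteq> M"
  obtains z where "z \<in> Z" "x N = (\<lambda>g. a g z) ` N" "x M = (\<lambda>g. a g z) ` M"
  using assms(2-4) conjunct2[OF assms(1)[unfolded completed_iff]] by meson

text \<open>The coset \<open>u N\<close> absorbs \<open>N\<close> on the right by normality, so
  acting with it on the \<open>N\<close>-orbit of \<open>z\<close> just applies \<open>u N\<close>
  to \<open>z\<close>. Translates of original points are compared in this normal form.\<close>

lemma move_point:
  assumes u: "u \<in> carrier (profinite_group G)" and z: "z \<in> Z"
  shows "move u (point z) = (\<lambda>N\<in>\<N>. (\<lambda>g. a g z) ` u N)"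
  unfolding completion_act_def
proof (rule restrict_ext)
  fix N assume N: "N \<in> \<N>"
  then have F: "N \<in> finite_index_normal G" by (rule family_finite_index)
  obtain g where g: "g \<in> carrier G" "u N = N #> g" using profinite_coset u F by blast
  have "u N <#> N = u N"
    using normal.rcos_sum[OF finite_index_normal_normal[OF F] g(1) one_closed] F g
    by (simp add: finite_index_normal_subgroup subgroup.subset)
  then show "(\<Union>g\<in>u N. a g ` point z N) = (\<lambda>g. a g z) ` u N"
    using act_image_set_mult[OF z, of "u N" N] N F u
    by (simp add: completion_point_def orbit_subgroup profinite_coset_subset
        finite_index_normal_subgroup subgroup.subset)
qed

lemma move_point_closed:
  assumes u: "u \<in> carrier (profinite_group G)" and z: "z \<in> Z"
  shows "move u (point z) \<in> completed"
  unfolding completed_iff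
proof (intro conjI ballI impI)
  show "move u (point z) \<in> extensional \<N>" by (simp add: completion_act_def)
  fix N M assume NM: "N \<in> \<N>" "M \<in> \<N>" "N \<subseteq> M"
  then obtain g where g: "g \<in> carrier G" "u N = N #> g" "u M = M #> g"
    using u family_finite_index unfolding profinite_carrier_iff by blast
  \<comment> \<open>The coset \<open>A g\<close> applied to \<open>z\<close> is the
    \<open>A\<close>-orbit of \<open>a g z\<close>, so this one point represents the coordinates at
    both \<open>N\<close> and \<open>M\<close>.\<close>
  have "(\<lambda>h. a h (a g z)) ` A = (\<lambda>h. a h z) ` (A #> g)" if "A \<in> \<N>" for A
    using that orbit_translate z g
    by (simp add: family_finite_index finite_index_normal_subgroup subgroup.subset)
  then show "\<exists>w\<in>Z. move u (point z) N = (\<lambda>g. a g w) ` N \<and> move u (point z) M = (\<lambda>g. a g w) ` M"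
    using NM g z act_closed by (intro bexI[of _ "a g z"]) (simp_all add: move_point u)
qed

lemma move_one_point:
  assumes "z \<in> Z"
  shows "move \<one>\<^bsub>profinite_group G\<^esub> (point z) = point z"
proof -
  have "\<one>\<^bsub>profinite_group G\<^esub> \<in> carrier (profinite_group G)"
    by (simp add: profinite_one_embed profinite_embed_closed)
  then show ?thesis
    using assms by (simp add: move_point)
      (simp add: completion_point_def orbit_subgroup profinite_one family_finite_index
        cong: restrict_cong)
qed

lemma point_closed: "z \<in> Z \<Longrightarrow> point z \<in> completed"
  using move_point_closed move_one_point group_profinite by (metis group.is_monoid monoid.one_closed)

lemma move_mult_point:
  assumes "u \<in> carrier (profinite_group G)" "v \<in> carrier (profinite_group G)" "z \<in> Z"
  shows "move (u \<otimes>\<^bsub>profinite_group G\<^esub> v) (point z) = move u (move v (point z))"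
proof -
  have "(\<lambda>g. a g z) ` (u N <#> v N) = (\<Union>g\<in>u N. a g ` (\<lambda>g. a g z) ` v N)" if "N \<in> \<N>" for N
    using that assms act_image_set_mult by (simp add: profinite_coset_subset family_finite_index)
  then show ?thesis
    using assms by (simp add: move_point profinite_mult_closed)
      (simp add: completion_act_def profinite_mult family_finite_index cong: restrict_cong)
qed

lemma move_embed:
  assumes "g \<in> carrier G" "z \<in> Z"
  shows "move (profinite_embed g) (point z) = point (a g z)"
proof -
  have "(\<lambda>h. a h z) ` profinite_embed g N = (\<lambda>h. a h (a g z)) ` N" if "N \<in> \<N>" for N
    using that assms orbit_translate[of z N g]
    by (simp add: profinite_embed_def family_finite_index finite_index_normal_subgroup
        subgroup.subset)
  then show ?thesis
    using assms by (simp add: move_point profinite_embed_closed)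
      (simp add: completion_point_def orbit_subgroup cong: restrict_cong)
qed

text \<open>All members of a thread lie in one \<open>G\<close>-orbit, which freeness identifies with \<open>G\<close>;
  hence no finiteness of the set of orbits is needed here.\<close>

lemma completed_eq_move_point:
  assumes x: "x \<in> completed"
  obtains u z where "u \<in> carrier (profinite_group G)" "z \<in> Z" "x = move u (point z)"
proof -
  let ?F = "finite_index_normal G"
  have sub: "subgroup N G" "N \<subseteq> carrier G" if "N \<in> \<N>" for N
    using that by (simp_all add: family_finite_index finite_index_normal_subgroup subgroup.subset)
  \<comment> \<open>One coordinate fixes the base point \<open>z\<close> once and for all; the other
    coordinates are compared with it through common lower bounds.\<close>
  obtain N0 where N0: "N0 \<in> \<N>" by (rule family_cofinal[OF carrier_finite_index_normal])
  obtain z where z: "z \<in> Z" "x N0 = (\<lambda>g. a g z) ` N0"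
    by (rule completed_coset[OF x N0 N0 order_refl])
  \<comment> \<open>At a lower bound \<open>L\<close> the coordinate has a representative
    \<open>w\<close> valid also at \<open>N\<close>, and a representative \<open>w'\<close> valid
    also at \<open>N0\<close>. Since \<open>w\<close> lies in the \<open>L\<close>-orbit of
    \<open>w'\<close>, it lies in the coordinate at \<open>N0\<close>, hence in the orbit of
    \<open>z\<close>.\<close>
  have rep: "\<exists>g\<in>carrier G. x N = (\<lambda>h. a h z) ` (N #> g)" if N: "N \<in> \<N>" for N
  proof -
    obtain L where L: "L \<in> \<N>" "L \<subseteq> N" "L \<subseteq> N0" using family_directed N N0 by blast
    obtain w where w: "w \<in> Z" "x L = (\<lambda>g. a g w) ` L" "x N = (\<lambda>g. a g w) ` N"
      using completed_coset[OF x L(1) N L(2)] by blast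
    obtain w' where w': "w' \<in> Z" "x L = (\<lambda>g. a g w') ` L" "x N0 = (\<lambda>g. a g w') ` N0"
      using completed_coset[OF x L(1) N0 L(3)] by blast
    have "\<one> \<in> L" using L(1) sub subgroup.one_closed by blast
    then have "w \<in> x L" using w act_one by (metis imageI)
    then have "w \<in> x N0" using w' L by blast
    then obtain g where g: "g \<in> carrier G" "w = a g z" using z sub N0 by blast
    then show ?thesis using w(3) orbit_translate[OF z(1) sub(2)[OF N]] by auto
  qed
  \<comment> \<open>Cosets found at \<open>N\<close> and at a smaller \<open>L\<close> agree at
    \<open>N\<close>: the coordinate at \<open>L\<close> contains \<open>w = (l h) z\<close> with
    \<open>l\<close> in \<open>L\<close>, freeness cancels \<open>z\<close>, and \<open>N\<close>
    absorbs \<open>l\<close>.\<close>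
  have comp: "N #> g = N #> h"
    if t: "N \<in> \<N>" "L \<in> \<N>" "L \<subseteq> N" "g \<in> carrier G" "h \<in> carrier G"
      "x N = (\<lambda>h. a h z) ` (N #> g)" "x L = (\<lambda>h. a h z) ` (L #> h)" for N L g h
  proof -
    obtain w where w: "w \<in> Z" "x L = (\<lambda>g. a g w) ` L" "x N = (\<lambda>g. a g w) ` N"
      using completed_coset[OF x t(2,1,3)] by blast
    have "\<one> \<in> L" using t sub subgroup.one_closed by blast
    then have "w \<in> x L" using w act_one by (metis imageI)
    then obtain l where l: "l \<in> L" "w = a (l \<otimes> h) z" using t by (auto simp: r_coset_def)
    have lc: "l \<in> carrier G" "l \<in> N" using l t sub by blast+
    have "x N = (\<lambda>g. a g z) ` (N #> (l \<otimes> h))"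
      using w(3) l lc t orbit_translate[OF z(1) sub(2)[OF t(1)]] by simp
    then have "N #> g = N #> (l \<otimes> h)"
      using t lc z sub by (metis orbit_image_eq_iff r_coset_subset_G m_closed)
    also have "\<dots> = (N #> l) #> h" using t lc sub by (simp add: coset_mult_assoc)
    also have "\<dots> = N #> h" using t lc sub coset_join2 by simp
    finally show ?thesis .
  qed
  \<comment> \<open>\<open>x\<close> has coordinates only at members of the family, while
    \<open>u\<close> needs one at every finite index normal subgroup \<open>H\<close>. It is read
    off at a chosen member \<open>\<nu> H\<close> below \<open>H\<close>.\<close>
  have "\<forall>H\<in>?F. \<exists>g N. g \<in> carrier G \<and> N \<in> \<N> \<and> N \<subseteq> H \<and> x N = (\<lambda>h. a h z) ` (N #> g)"
    using family_cofinal rep by metis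
  then obtain \<gamma> \<nu> where gn: "\<And>H. H \<in> ?F \<Longrightarrow> \<gamma> H \<in> carrier G \<and> \<nu> H \<in> \<N> \<and> \<nu> H \<subseteq> H \<and>
      x (\<nu> H) = (\<lambda>h. a h z) ` (\<nu> H #> \<gamma> H)" by metis
  define u where "u = (\<lambda>H\<in>?F. H #> \<gamma> H)"
  \<comment> \<open>Independence of that choice: any member below \<open>H\<close> gives the same
    coset at \<open>H\<close>, as both are compared with a common lower bound.\<close>
  have uH: "u H = H #> g"
    if t: "H \<in> ?F" "N \<in> \<N>" "N \<subseteq> H" "g \<in> carrier G" "x N = (\<lambda>h. a h z) ` (N #> g)" for H N g
  proof -
    obtain L where L: "L \<in> \<N>" "L \<subseteq> N" "L \<subseteq> \<nu> H" using family_directed t(1,2) gn by metis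
    obtain h where h: "h \<in> carrier G" "x L = (\<lambda>k. a k z) ` (L #> h)"
      using rep[OF L(1)] by blast
    note H = finite_index_normal_subgroup[OF t(1)]
    have n: "\<gamma> H \<in> carrier G" "\<nu> H \<in> \<N>" "\<nu> H \<subseteq> H" "x (\<nu> H) = (\<lambda>h. a h z) ` (\<nu> H #> \<gamma> H)"
      using gn[OF t(1)] by simp_all
    have "N #> g = N #> h" using t(2) L(1,2) t(4) h(1) t(5) h(2) by (rule comp)
    then have "H #> g = H #> h"
      by (rule r_coset_eq_mono[OF sub(1)[OF t(2)] H t(3) t(4) h(1)])
    moreover have "\<nu> H #> \<gamma> H = \<nu> H #> h" using n(2) L(1,3) n(1) h(1) n(4) h(2) by (rule comp)
    then have "H #> \<gamma> H = H #> h"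
      by (rule r_coset_eq_mono[OF sub(1)[OF n(2)] H n(3) n(1) h(1)])
    ultimately show ?thesis using t by (simp add: u_def)
  qed
  have u: "u \<in> carrier (profinite_group G)"
    unfolding profinite_carrier_iff
  proof (intro conjI ballI impI)
    show "u \<in> extensional ?F" by (simp add: u_def)
    fix N M assume NM: "N \<in> ?F" "M \<in> ?F" "N \<subseteq> M"
    then show "\<exists>g\<in>carrier G. u N = N #> g \<and> u M = M #> g"
      using uH gn by (meson order_trans)
  qed
  have "x = move u (point z)"
  proof (rule extensionalityI[of _ \<N>])
    show "x \<in> extensional \<N>" using x completed_iff by blast
    show "move u (point z) \<in> extensional \<N>" by (simp add: completion_act_def)
    fix N assume N: "N \<in> \<N>"
    obtain g where "g \<in> carrier G" "x N = (\<lambda>h. a h z) ` (N #> g)" using rep N by blast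
    then show "x N = move u (point z) N"
      using N uH family_finite_index by (simp add: move_point u z)
  qed
  then show ?thesis using that u z by blast
qed

lemma move_closed:
  assumes "u \<in> carrier (profinite_group G)" "x \<in> completed"
  shows "move u x \<in> completed"
  using assms completed_eq_move_point move_mult_point move_point_closed profinite_mult_closed by metis

text \<open>Every completed point is a translate of an original one, so associativity in the
  profinite group reduces the action law to \<open>move_mult_point\<close>.\<close>

lemma move_mult:
  assumes "u \<in> carrier (profinite_group G)" "v \<in> carrier (profinite_group G)" "x \<in> completed"
  shows "move (u \<otimes>\<^bsub>profinite_group G\<^esub> v) x = move u (move v x)"
proof -
  interpret P: group "profinite_group G" by (rule group_profinite)
  obtain w z where "w \<in> carrier (profinite_group G)" "z \<in> Z" "x = move w (point z)"
    using assms completed_eq_move_point by blast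
  then show ?thesis using assms by (simp add: move_mult_point[symmetric] P.m_assoc)
qed

lemma move_one:
  assumes "x \<in> completed"
  shows "move \<one>\<^bsub>profinite_group G\<^esub> x = x"
proof -
  interpret P: group "profinite_group G" by (rule group_profinite)
  obtain w z where "w \<in> carrier (profinite_group G)" "z \<in> Z" "x = move w (point z)"
    using assms completed_eq_move_point by blast
  then show ?thesis by (simp add: move_mult_point[symmetric])
qed

text \<open>A single coordinate provides \<open>h z = k w\<close> with \<open>h\<close> in
  \<open>u N\<close> and \<open>k\<close> in \<open>v N\<close>, so \<open>g = k^-1 h\<close>
  carries \<open>z\<close> to \<open>w\<close>. With \<open>w\<close> replaced by
  \<open>g z\<close>, freeness turns the equality of orbits at each \<open>M\<close> into
  \<open>u M = v M g\<close>, and the coordinates on the family determine \<open>u\<close>.\<close>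

lemma move_point_eqD:
  assumes u: "u \<in> carrier (profinite_group G)" and v: "v \<in> carrier (profinite_group G)"
    and z: "z \<in> Z" and w: "w \<in> Z" and eq: "move u (point z) = move v (point w)"
  obtains g where "g \<in> carrier G" "w = a g z" "u = v \<otimes>\<^bsub>profinite_group G\<^esub> profinite_embed g"
proof -
  let ?P = "profinite_group G"
  have eqN: "(\<lambda>g. a g z) ` u N = (\<lambda>g. a g w) ` v N" if "N \<in> \<N>" for N
    using fun_cong[OF eq, of N] that by (simp add: move_point u v z w)
  obtain N where N: "N \<in> \<N>" using family_cofinal[OF carrier_finite_index_normal] by blast
  have NF: "N \<in> finite_index_normal G" using N by (rule family_finite_index)
  obtain h where h: "h \<in> u N" using profinite_coset_nonempty u NF by blast
  then obtain k where k: "k \<in> v N" "a h z = a k w" using eqN[OF N] by blast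
  have hk: "h \<in> carrier G" "k \<in> carrier G" using h k u v NF profinite_coset_subset by blast+
  define g where "g = inv k \<otimes> h"
  have g: "g \<in> carrier G" using hk by (simp add: g_def)
  have "a g z = a (inv k) (a k w)" using hk z k by (simp add: g_def act_mult)
  also have "\<dots> = w" using hk w by (simp add: act_mult[symmetric] act_one)
  finally have wg: "w = a g z" by simp
  have "u = v \<otimes>\<^bsub>?P\<^esub> profinite_embed g"
  proof (rule profinite_ext_family[OF u profinite_mult_closed[OF v profinite_embed_closed[OF g]]])
    fix M assume M: "M \<in> \<N>"
    then have MF: "M \<in> finite_index_normal G" by (rule family_finite_index)
    obtain m where m: "m \<in> carrier G" "v M = M #> m" using profinite_coset v MF by blast
    have Mc: "M \<subseteq> carrier G" using MF finite_index_normal_subgroup subgroup.subset by blast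
    have "(\<lambda>g. a g z) ` u M = (\<lambda>h. a h z) ` (v M #> g)"
      using eqN[OF M] orbit_translate[OF z _ g] v MF wg profinite_coset_subset by simp
    then have "u M = v M #> g"
      using orbit_image_eq_iff[OF z] u v g MF by (metis profinite_coset_subset r_coset_subset_G)
    also have "\<dots> = M #> (m \<otimes> g)" using m g Mc by (simp add: coset_mult_assoc)
    also have "\<dots> = (v \<otimes>\<^bsub>?P\<^esub> profinite_embed g) M"
      using m g MF by (subst profinite_mult_coset[where g = m and h = g])
        (auto simp: profinite_embed_def)
    finally show "u M = (v \<otimes>\<^bsub>?P\<^esub> profinite_embed g) M" .
  qed
  then show ?thesis using that g wg by blast
qed

end

section \<open>Equivariant maps between completed free actions\<close>

locale free_set_map = Z: free_set_action G \<N> a Z + W: free_set_action G \<N> a W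
  for G :: "('g, 'b) monoid_scheme" (structure) and \<N> a and Z W :: "'z set" +
  fixes p :: "'z \<Rightarrow> 'z"
  assumes map_closed: "\<And>z. z \<in> Z \<Longrightarrow> p z \<in> W"
    and map_equivariant: "\<And>g z. g \<in> carrier G \<Longrightarrow> z \<in> Z \<Longrightarrow> p (a g z) = a g (p z)"
begin

lemma completion_map_move_point:
  assumes "u \<in> carrier (profinite_group G)" "z \<in> Z"
  shows "completion_map \<N> p (Z.move u (Z.point z)) = W.move u (W.point (p z))"
proof -
  have "p ` (\<lambda>g. a g z) ` u N = (\<lambda>g. a g (p z)) ` u N" if "N \<in> \<N>" for N
    unfolding image_image
    using that assms map_equivariant Z.profinite_coset_subset Z.family_finite_index
    by (intro image_cong) blast+
  then show ?thesis
    using assms map_closed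
    by (simp add: completion_map_def Z.move_point W.move_point cong: restrict_cong)
qed

lemma completion_map_closed:
  assumes "y \<in> Z.completed"
  shows "completion_map \<N> p y \<in> W.completed"
  using assms Z.completed_eq_move_point completion_map_move_point W.move_point_closed map_closed
  by metis

text \<open>Backwards, write \<open>y = v z\<close>. Its image \<open>v (p z)\<close> equals some
  \<open>u w\<close>, so \<open>move_point_eqD\<close> in the target gives \<open>v = u g\<close>
  with \<open>g\<close> discrete, and \<open>y = u (g z)\<close>. As an equivalence, the statement
  can be used to go up from a cell to an occurrence and down again to another cell.\<close>

lemma completion_map_original_iff:
  assumes u: "u \<in> carrier (profinite_group G)" and y: "y \<in> Z.completed"
  shows "completion_map \<N> p y \<in> W.move u ` W.point ` W \<longleftrightarrow> y \<in> Z.move u ` Z.point ` Z"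
proof
  assume "completion_map \<N> p y \<in> W.move u ` W.point ` W"
  then obtain w where w: "w \<in> W" "completion_map \<N> p y = W.move u (W.point w)" by blast
  obtain v z where v: "v \<in> carrier (profinite_group G)" "z \<in> Z" "y = Z.move v (Z.point z)"
    using y Z.completed_eq_move_point by blast
  then have "W.move v (W.point (p z)) = W.move u (W.point w)"
    using w completion_map_move_point by simp
  then obtain g where g: "g \<in> carrier G" "v = u \<otimes>\<^bsub>profinite_group G\<^esub> Z.profinite_embed g"
    using W.move_point_eqD v u w map_closed by metis
  have "y = Z.move u (Z.point (a g z))"
    using g v u by (simp add: Z.move_mult_point Z.profinite_embed_closed Z.move_embed)
  then show "y \<in> Z.move u ` Z.point ` Z" using g v Z.act_closed by blast
next
  assume "y \<in> Z.move u ` Z.point ` Z"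
  then show "completion_map \<N> p y \<in> W.move u ` W.point ` W"
    using completion_map_move_point[OF u] map_closed by auto
qed

end

section \<open>Cells of a regular square complex\<close>

text \<open>The empty set is a default value for occurrences; \<open>support\<close> is applied only
  to members of \<open>cell_tags\<close>.\<close>

fun support :: "'p relt \<Rightarrow> 'p set" where
  "support (Vert v) = {v}"
| "support (Edge e) = e"
| "support (Square q) = q"
| "support (EndOcc e \<epsilon>) = {}"
| "support (SideOcc q j \<epsilon>) = {}"

text \<open>Cells keep their tags so that a predicate on them matches the components of the residual
  complex.\<close>

definition cell_tags :: "'p square_complex \<Rightarrow> 'p relt set" where
  "cell_tags C = cubical_set C C0 \<union> cubical_set C C1 \<union> cubical_set C C2"

locale regular_complex =
  fixes C :: "'p square_complex"
  assumes regular: "regular_square_complex C"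
begin

abbreviation X :: "'p topology" where "X \<equiv> realization C"

lemmas regular_unfolded = regular[unfolded regular_square_complex_def Let_def]

lemmas Hausdorff = regular_unfolded[THEN conjunct1]

lemmas cells_cover = regular_unfolded[THEN conjunct2, THEN conjunct1]

lemmas cells_pairwise = regular_unfolded[THEN conjunct2, THEN conjunct2, THEN conjunct1]

lemmas edge_char =
  regular_unfolded[THEN conjunct2, THEN conjunct2, THEN conjunct2, THEN conjunct1, THEN bspec]

lemmas square_char =
  regular_unfolded[THEN conjunct2, THEN conjunct2, THEN conjunct2, THEN conjunct2, THEN conjunct1,
    THEN bspec]

lemmas weak_topology =
  regular_unfolded[THEN conjunct2, THEN conjunct2, THEN conjunct2, THEN conjunct2, THEN conjunct2,
    rule_format]

lemma cells_disjoint: "c \<in> cells C \<Longrightarrow> d \<in> cells C \<Longrightarrow> x \<in> c \<Longrightarrow> x \<in> d \<Longrightarrow> c = d"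
  using cells_pairwise by (auto simp: pairwise_def disjnt_def)

lemma vert_cell: "v \<in> verts C \<Longrightarrow> {v} \<in> cells C"
  by (simp add: cells_def)

lemma edge_cell: "e \<in> edges C \<Longrightarrow> e \<in> cells C"
  by (simp add: cells_def)

lemma square_cell: "q \<in> squares C \<Longrightarrow> q \<in> cells C"
  by (simp add: cells_def)

lemma cell_subset: "c \<in> cells C \<Longrightarrow> c \<subseteq> topspace X"
  using cells_cover by blast

lemma homeomorphic_onto_closure:
  assumes "homeomorphic_map (top_of_set K) (subtopology X (X closure_of c)) f"
  shows "X closure_of c = f ` K" "inj_on f K"
proof -
  have "topspace X \<inter> X closure_of c = X closure_of c"
    using closure_of_subset_topspace[of X c] by blast
  then show "X closure_of c = f ` K"
    using homeomorphic_imp_surjective_map[OF assms] by simp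
  show "inj_on f K" using homeomorphic_imp_injective_map[OF assms] by simp
qed

lemma closure_vert: "v \<in> verts C \<Longrightarrow> X closure_of {v} = {v}"
  using vert_cell[of v] cell_subset[of "{v}"] Hausdorff
  by (simp add: closedin_Hausdorff_singleton closure_of_closedin)

lemma edge_image: "e \<in> edges C \<Longrightarrow> chi1 C e ` {-1<..<1} = e"
  using edge_char by simp

lemma chi1_vert: "e \<in> edges C \<Longrightarrow> \<epsilon> \<in> {-1, 1} \<Longrightarrow> chi1 C e \<epsilon> \<in> verts C"
  by (rule subsetD[OF edge_char[THEN conjunct2, THEN conjunct2] imageI])

lemmas chi1_inj = homeomorphic_onto_closure(2)[OF edge_char[THEN conjunct1]]

lemmas closure_edge = homeomorphic_onto_closure(1)[OF edge_char[THEN conjunct1]]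

lemma closure_edge_ends:
  assumes "e \<in> edges C"
  shows "X closure_of e = e \<union> chi1 C e ` {-1, 1}"
proof -
  have "{-1..1} = {-1<..<1} \<union> {-1, 1::real}" by auto
  then show ?thesis using closure_edge[OF assms] edge_image[OF assms] by (metis image_Un)
qed

lemma square_image: "q \<in> squares C \<Longrightarrow> chi2 C q ` ({-1<..<1} \<times> {-1<..<1}) = q"
  using square_char by simp

lemmas chi2_inj = homeomorphic_onto_closure(2)[OF square_char[THEN conjunct1]]

lemmas closure_square = homeomorphic_onto_closure(1)[OF square_char[THEN conjunct1]]

text \<open>The isometry \<open>t -> \<sigma> t\<close> preserves both the open and the closed
  interval, so it disappears from images. The edge given by the cubical condition is therefore the
  image of the open side, and its closure the image of the closed side.\<close>

lemma side_edge:
  assumes q: "q \<in> squares C" and j: "j \<in> {1, 2}" and \<epsilon>: "\<epsilon> \<in> {-1, 1}"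
  shows "chi2 C q ` open_side j \<epsilon> \<in> edges C"
    and "X closure_of (chi2 C q ` open_side j \<epsilon>) = chi2 C q ` side_point j \<epsilon> ` {-1..1}"
proof -
  obtain e \<sigma> where e: "e \<in> edges C" and \<sigma>: "\<sigma> \<in> {-1, 1::real}"
    and eq: "\<And>t. t \<in> {-1..1} \<Longrightarrow> chi2 C q (side_point j \<epsilon> t) = chi1 C e (\<sigma> * t)"
    using square_char[OF q] j \<epsilon> by meson
  have s: "(\<lambda>t. \<sigma> * t) ` {-1<..<1} = {-1<..<1}" "(\<lambda>t. \<sigma> * t) ` {-1..1} = {-1..1}"
    using \<sigma> by auto
  have "chi2 C q ` open_side j \<epsilon> = (\<lambda>t. chi1 C e (\<sigma> * t)) ` {-1<..<1}"
    unfolding open_side_def image_image using eq by (intro image_cong) auto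
  also have "\<dots> = chi1 C e ` (\<lambda>t. \<sigma> * t) ` {-1<..<1}" by (simp add: image_image)
  also have "\<dots> = e" using s edge_image[OF e] by simp
  finally have se: "chi2 C q ` open_side j \<epsilon> = e" .
  then show "chi2 C q ` open_side j \<epsilon> \<in> edges C" using e by simp
  have "chi2 C q ` side_point j \<epsilon> ` {-1..1} = (\<lambda>t. chi1 C e (\<sigma> * t)) ` {-1..1}"
    unfolding image_image using eq by (intro image_cong) auto
  also have "\<dots> = chi1 C e ` (\<lambda>t. \<sigma> * t) ` {-1..1}" by (simp add: image_image)
  finally show "X closure_of (chi2 C q ` open_side j \<epsilon>) = chi2 C q ` side_point j \<epsilon> ` {-1..1}"
    using se s closure_edge[OF e] by simp
qed

text \<open>The frontier of the square is covered by its closed sides; corners are reached as ends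
  of side edges. In this form questions about the closure of a square reduce to closures of
  edges.\<close>

lemma closure_square_sides:
  assumes q: "q \<in> squares C"
  shows "X closure_of q = q \<union> (\<Union>j\<in>{1, 2}. \<Union>\<epsilon>\<in>{-1, 1}. X closure_of (chi2 C q ` open_side j \<epsilon>))"
proof -
  have "({-1..1} \<times> {-1..1} :: (real \<times> real) set) = {-1<..<1} \<times> {-1<..<1} \<union>
      (\<Union>j\<in>{1, 2}. \<Union>\<epsilon>\<in>{-1, 1}. side_point j \<epsilon> ` {-1..1})"
  proof (rule equalityI; rule subsetI)
    fix x :: "real \<times> real"
    assume x: "x \<in> {-1..1} \<times> {-1..1}"
    obtain s t where st: "x = (s, t)" by fastforce
    consider "s \<in> {-1, 1}" | "t \<in> {-1, 1}" | "s \<in> {-1<..<1}" "t \<in> {-1<..<1}"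
      using x st by fastforce
    then show "x \<in> {-1<..<1} \<times> {-1<..<1} \<union>
      (\<Union>j\<in>{1, 2}. \<Union>\<epsilon>\<in>{-1, 1}. side_point j \<epsilon> ` {-1..1})"
    proof cases
      case 1
      have "x = side_point 1 s t" using st by (simp add: side_point_def)
      then show ?thesis using 1 x st by auto
    next
      case 2
      have "x = side_point 2 t s" using st by (simp add: side_point_def)
      then show ?thesis using 2 x st by auto
    next
      case 3
      then show ?thesis using st by simp
    qed
  qed (auto simp: side_point_def)
  then have "X closure_of q = chi2 C q ` ({-1<..<1} \<times> {-1<..<1} \<union>
      (\<Union>j\<in>{1, 2}. \<Union>\<epsilon>\<in>{-1, 1}. side_point j \<epsilon> ` {-1..1}))"
    using closure_square[OF q] by simp
  also have "\<dots> = q \<union> (\<Union>j\<in>{1, 2}. \<Union>\<epsilon>\<in>{-1, 1}. chi2 C q ` side_point j \<epsilon> ` {-1..1})"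
    by (simp only: image_Un square_image[OF q] image_UN)
  also have "\<dots> = q \<union> (\<Union>j\<in>{1, 2}. \<Union>\<epsilon>\<in>{-1, 1}. X closure_of (chi2 C q ` open_side j \<epsilon>))"
    using side_edge(2)[OF q] by (intro arg_cong2[of _ _ _ _ "(\<union>)"] SUP_cong refl) simp
  finally show ?thesis .
qed

lemma edge_not_singleton:
  assumes "e \<in> edges C"
  shows "e \<noteq> {v}"
proof
  assume "e = {v}"
  then have "chi1 C e 0 = v" "chi1 C e (1/2) = v" using edge_image[OF assms] by force+
  then show False using inj_onD[OF chi1_inj[OF assms], of 0 "1/2"] by auto
qed

lemma square_not_singleton:
  assumes "q \<in> squares C"
  shows "q \<noteq> {v}"
proof
  assume "q = {v}"
  then have "chi2 C q (0, 0) = v" "chi2 C q (1/2, 0) = v" using square_image[OF assms] by force+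
  then show False using inj_onD[OF chi2_inj[OF assms], of "(0, 0)" "(1/2, 0)"] by auto
qed

text \<open>The frontier of an edge has two points, that of a square has more.\<close>

lemma edge_not_square:
  assumes e: "e \<in> edges C" and q: "q \<in> squares C"
  shows "e \<noteq> q"
proof
  assume eq: "e = q"
  have fr: "chi2 C q (s, t) \<in> {chi1 C e (-1), chi1 C e 1}"
    if st: "s \<in> {-1, 1}" "t \<in> {-1, 1}" for s t
  proof -
    have "chi2 C q (s, t) \<notin> q"
    proof
      assume "chi2 C q (s, t) \<in> q"
      then obtain x where x: "x \<in> {-1<..<1} \<times> {-1<..<1}" "chi2 C q (s, t) = chi2 C q x"
        using square_image[OF q] by blast
      have "(s, t) = x" by (rule inj_onD[OF chi2_inj[OF q] x(2)]) (use st x in auto)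
      then show False using x st by auto
    qed
    moreover have "chi2 C q (s, t) \<in> X closure_of q" using closure_square[OF q] st by auto
    ultimately show ?thesis using eq closure_edge_ends[OF e] by auto
  qed
  have inj: "chi2 C q x \<noteq> chi2 C q y"
    if "x \<noteq> y" "x \<in> {-1..1} \<times> {-1..1}" "y \<in> {-1..1} \<times> {-1..1}" for x y
    using inj_onD[OF chi2_inj[OF q]] that by blast
  \<comment> \<open>Three distinct corners do not fit into the two endpoints of
    \<open>e\<close>.\<close>
  have "chi2 C q (1, 1) \<noteq> chi2 C q (1, -1)" "chi2 C q (1, 1) \<noteq> chi2 C q (-1, 1)"
    "chi2 C q (1, -1) \<noteq> chi2 C q (-1, 1)"
    by (intro inj; simp)+
  then show False using fr[of 1 1] fr[of 1 "-1"] fr[of "-1" 1] by auto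
qed

section \<open>Propagation of a predicate through a connected complex\<close>

lemma cell_tags_cases:
  assumes "z \<in> cell_tags C"
  obtains v where "v \<in> verts C" "z = Vert v" | e where "e \<in> edges C" "z = Edge e"
    | q where "q \<in> squares C" "z = Square q"
  using assms unfolding cell_tags_def by auto

lemma support_cell: "z \<in> cell_tags C \<Longrightarrow> support z \<in> cells C"
  by (elim cell_tags_cases) (simp_all add: vert_cell edge_cell square_cell)

lemma cell_tag: "c \<in> cells C \<Longrightarrow> \<exists>z\<in>cell_tags C. support z = c"
  unfolding cells_def cell_tags_def cubical_set.simps
  by (elim UnE imageE) (auto intro: bexI[of _ "Edge c"] bexI[of _ "Square c"] bexI[of _ "Vert _"])

text \<open>Disjointness makes the point determine its open cell, and vertices, edges and squares
  are never equal as sets, so the cell determines its tag.\<close>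

lemma cell_tag_unique:
  assumes z: "z \<in> cell_tags C" and w: "w \<in> cell_tags C" and x: "x \<in> support z" "x \<in> support w"
  shows "z = w"
proof -
  have "support z = support w"
    using cells_disjoint[OF support_cell[OF z] support_cell[OF w] x] .
  then show ?thesis
    using z w edge_not_singleton square_not_singleton edge_not_square
    by (elim cell_tags_cases) (metis support.simps(1-3) singleton_inject)+
qed

text \<open>A point on the frontier of a square lies in a closed side; there it is in the open edge
  or is one of its ends. Each passage to a face preserves the truth value of
  \<open>P\<close>.\<close>

lemma closure_support_face:
  assumes edge: "\<And>e \<epsilon>. e \<in> edges C \<Longrightarrow> \<epsilon> \<in> {-1, 1} \<Longrightarrow> P (Edge e) \<longleftrightarrow> P (Vert (chi1 C e \<epsilon>))"
    and square: "\<And>q j \<epsilon>. q \<in> squares C \<Longrightarrow> j \<in> {1, 2} \<Longrightarrow> \<epsilon> \<in> {-1, 1} \<Longrightarrow>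
        P (Square q) \<longleftrightarrow> P (Edge (chi2 C q ` open_side j \<epsilon>))"
    and z: "z \<in> cell_tags C" and x: "x \<in> X closure_of (support z)"
  shows "\<exists>w\<in>cell_tags C. x \<in> support w \<and> (P w \<longleftrightarrow> P z)"
proof -
  have E: "\<exists>w\<in>cell_tags C. x \<in> support w \<and> (P w \<longleftrightarrow> P (Edge e))"
    if e: "e \<in> edges C" "x \<in> X closure_of e" for e
  proof (cases "x \<in> e")
    case True
    then show ?thesis using e by (intro bexI[of _ "Edge e"]) (auto simp: cell_tags_def)
  next
    case False
    then obtain \<epsilon> where "\<epsilon> \<in> {-1, 1}" "x = chi1 C e \<epsilon>" using e closure_edge_ends by blast
    then show ?thesis
      using e chi1_vert edge by (intro bexI[of _ "Vert x"]) (auto simp: cell_tags_def)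
  qed
  from z show ?thesis
  proof (cases rule: cell_tags_cases)
    case (1 v)
    then show ?thesis using x z closure_vert by (intro bexI[of _ z]) auto
  next
    case (2 e)
    then show ?thesis using E x by simp
  next
    case (3 q)
    show ?thesis
    proof (cases "x \<in> q")
      case True
      then show ?thesis using z 3 by (intro bexI[of _ z]) auto
    next
      case False
      then obtain j \<epsilon> where j: "j \<in> {1, 2}" "\<epsilon> \<in> {-1, 1}"
        "x \<in> X closure_of (chi2 C q ` open_side j \<epsilon>)"
        using x 3 closure_square_sides[OF 3(1)] by auto
      then show ?thesis using E[OF side_edge(1)[OF 3(1) j(1,2)] j(3)] square[OF 3(1) j(1,2)] 3 by simp
    qed
  qed
qed

text \<open>Let \<open>U b\<close> be the union of the cells on which \<open>P\<close> has truth
  value \<open>b\<close>. By \<open>closure_support_face\<close> a closed cell lies inside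
  \<open>U b\<close> or misses it, so \<open>U b\<close> is closed in the weak topology. If both
  truth values occurred, \<open>U True\<close> and \<open>U False\<close> would disconnect the
  space.\<close>

lemma connected_cells_induct:
  assumes conn: "connected_complex C"
    and edge: "\<And>e \<epsilon>. e \<in> edges C \<Longrightarrow> \<epsilon> \<in> {-1, 1} \<Longrightarrow> P (Edge e) \<longleftrightarrow> P (Vert (chi1 C e \<epsilon>))"
    and square: "\<And>q j \<epsilon>. q \<in> squares C \<Longrightarrow> j \<in> {1, 2} \<Longrightarrow> \<epsilon> \<in> {-1, 1} \<Longrightarrow>
        P (Square q) \<longleftrightarrow> P (Edge (chi2 C q ` open_side j \<epsilon>))"
    and z0: "z0 \<in> cell_tags C" "P z0" and z: "z \<in> cell_tags C"
  shows "P z"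
proof (rule ccontr)
  assume nP: "\<not> P z"
  define U where "U b = \<Union>(support ` {z \<in> cell_tags C. P z \<longleftrightarrow> b})" for b
  have nonempty: "support w \<noteq> {}" if "w \<in> cell_tags C" for w
    using that edge_image square_image by (elim cell_tags_cases) fastforce+
  have closed: "closedin X (U b)" for b
  proof (rule weak_topology)
    show "U b \<subseteq> topspace X"
      unfolding U_def using support_cell cell_subset by blast
    fix c assume "c \<in> cells C"
    then obtain w where w: "w \<in> cell_tags C" "support w = c" using cell_tag by blast
    have face: "\<exists>w'\<in>cell_tags C. x \<in> support w' \<and> (P w' \<longleftrightarrow> P w)" if "x \<in> X closure_of c" for x
      using closure_support_face[where P = P, OF edge square w(1)] that w(2) by blast
    show "closedin X (U b \<inter> X closure_of c)"
    proof (cases "P w \<longleftrightarrow> b")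
      case True
      then have "X closure_of c \<subseteq> U b" using face unfolding U_def by fastforce
      then show ?thesis by (simp add: Int_absorb1)
    next
      case False
      have "x \<notin> U b" if "x \<in> X closure_of c" for x
        using face[OF that] False cell_tag_unique unfolding U_def by fastforce
      then have "U b \<inter> X closure_of c = {}" by blast
      then show ?thesis by simp
    qed
  qed
  have "topspace X \<subseteq> U True \<union> U False"
  proof
    fix x assume "x \<in> topspace X"
    then obtain c where "c \<in> cells C" "x \<in> c" using cells_cover by blast
    then obtain w where "w \<in> cell_tags C" "x \<in> support w" using cell_tag by blast
    then show "x \<in> U True \<union> U False" unfolding U_def by auto
  qed
  moreover have "U True \<inter> U False = {}"
    unfolding U_def using cell_tag_unique by fastforce
  moreover have "U True \<noteq> {}" "U False \<noteq> {}"
    unfolding U_def using z0 z nP nonempty by fastforce+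
  moreover have "connected_space X" using conn by (simp add: connected_complex_def)
  ultimately show False unfolding connected_space_closedin using closed by metis
qed

text \<open>Squares have side edges and edges have ends, so a complex without vertices has no cells.
  This provides the base vertex.\<close>

lemma verts_nonempty:
  assumes "connected_complex C"
  shows "verts C \<noteq> {}"
proof
  assume v: "verts C = {}"
  then have e: "edges C = {}" using chi1_vert by fastforce
  then have "squares C = {}" using side_edge(1)[of _ 1 1] by fastforce
  then have "topspace X = {}" using v e cells_cover by (simp add: cells_def)
  then show False using assms by (simp add: connected_complex_def)
qed

lemma open_side_unique:
  assumes q: "q \<in> squares C" and j: "j \<in> {1, 2}" "j' \<in> {1, 2}" and \<epsilon>: "\<epsilon> \<in> {-1, 1}" "\<epsilon>' \<in> {-1, 1}"
    and eq: "chi2 C q ` open_side j \<epsilon> = chi2 C q ` open_side j' \<epsilon>'"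
  shows "j = j' \<and> \<epsilon> = \<epsilon>'"
proof -
  have sub: "open_side i \<delta> \<subseteq> {-1..1} \<times> {-1..1}" if "\<delta> \<in> {-1, 1}" for i \<delta>
    using that by (auto simp: open_side_def side_point_def)
  have "open_side j \<epsilon> = open_side j' \<epsilon>'"
    using eq inj_on_image_eq_iff[OF chi2_inj[OF q] sub[OF \<epsilon>(1)] sub[OF \<epsilon>(2)]] by simp
  \<comment> \<open>The midpoint of a side lies in no other open side: one coordinate is 0 and the
    other has absolute value 1.\<close>
  moreover have "side_point j \<epsilon> 0 \<in> open_side j \<epsilon>" by (simp add: open_side_def)
  ultimately have "side_point j \<epsilon> 0 \<in> open_side j' \<epsilon>'" by simp
  then show ?thesis using j \<epsilon> by (auto simp: open_side_def side_point_def split: if_splits)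
qed

end

text \<open>Conjugating \<open>f\<close> by the parametrization \<open>c\<close> gives a continuous
  self-map of the compact convex set \<open>K\<close>; a fixed point of it in \<open>K\<close> is
  carried by \<open>c\<close> to one of \<open>f\<close>.\<close>

lemma convex_cell_fixed_point:
  fixes K :: "'a::euclidean_space set"
  assumes K: "compact K" "convex K" "K \<noteq> {}"
    and c: "homeomorphic_map (top_of_set K) (subtopology X S) c"
    and f: "continuous_map X X f" "f ` S \<subseteq> S"
  shows "\<exists>x\<in>topspace X \<inter> S. f x = x"
proof -
  let ?Y = "subtopology X S"
  obtain d where d: "homeomorphic_maps (top_of_set K) ?Y c d"
    using c homeomorphic_map_maps by blast
  then have cd: "continuous_map (top_of_set K) ?Y c" "continuous_map ?Y (top_of_set K) d"
    "\<And>y. y \<in> topspace ?Y \<Longrightarrow> c (d y) = y"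
    unfolding homeomorphic_maps_def by auto
  have fY: "continuous_map ?Y ?Y f"
    using f by (auto simp: continuous_map_in_subtopology continuous_map_from_subtopology)
  have "continuous_map (top_of_set K) (top_of_set K) (d \<circ> (f \<circ> c))"
    by (rule continuous_map_compose[OF continuous_map_compose[OF cd(1) fY] cd(2)])
  then have h: "continuous_on K (d \<circ> (f \<circ> c))" "d \<circ> (f \<circ> c) \<in> K \<rightarrow> K"
    by (auto simp: continuous_map_in_subtopology)
  obtain x where x: "x \<in> K" "(d \<circ> (f \<circ> c)) x = x" using brouwer[OF K h] by blast
  have cx: "c x \<in> topspace ?Y" using cd(1) x(1) by (auto simp: continuous_map_def)
  then have "f (c x) \<in> topspace ?Y" using fY by (auto simp: continuous_map_def)
  then have "f (c x) = c x" using cd(3) x(2) by fastforce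
  then show ?thesis using cx by auto
qed

section \<open>Free cellular actions\<close>

locale complex_action = group G + regular_complex C
  for G :: "('g, 'b) monoid_scheme" (structure) and C :: "'p square_complex" +
  fixes \<phi> :: "'g \<Rightarrow> 'p \<Rightarrow> 'p"
  assumes cellular: "cellular_action G C \<phi>" and free: "free_action G C \<phi>"
begin

lemma points_action: "group_action G (topspace X) \<phi>"
  using cellular by (simp add: cellular_action_def)

lemma point_mult:
  "g \<in> carrier G \<Longrightarrow> h \<in> carrier G \<Longrightarrow> x \<in> topspace X \<Longrightarrow> \<phi> (g \<otimes> h) x = \<phi> g (\<phi> h x)"
  using group_action.composition_rule[OF points_action] by blast

lemma point_one: "x \<in> topspace X \<Longrightarrow> \<phi> \<one> x = x"
  using group_action.id_eq_one[OF points_action] by (metis restrict_apply')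

lemma image_mult:
  "g \<in> carrier G \<Longrightarrow> h \<in> carrier G \<Longrightarrow> c \<subseteq> topspace X \<Longrightarrow> \<phi> (g \<otimes> h) ` c = \<phi> g ` \<phi> h ` c"
  unfolding image_image using point_mult by (intro image_cong) auto

lemma image_one: "c \<subseteq> topspace X \<Longrightarrow> \<phi> \<one> ` c = c"
  using point_one by (metis (no_types, lifting) image_cong image_ident subsetD)

lemma homeo: "g \<in> carrier G \<Longrightarrow> homeomorphic_map X X (\<phi> g)"
  using cellular by (simp add: cellular_action_def)

lemma vert_act: "g \<in> carrier G \<Longrightarrow> v \<in> verts C \<Longrightarrow> \<phi> g v \<in> verts C"
  and edge_act: "g \<in> carrier G \<Longrightarrow> e \<in> edges C \<Longrightarrow> \<phi> g ` e \<in> edges C"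
  and square_act: "g \<in> carrier G \<Longrightarrow> q \<in> squares C \<Longrightarrow> \<phi> g ` q \<in> squares C"
  using cellular by (simp_all add: cellular_action_def)

lemma closure_act:
  "g \<in> carrier G \<Longrightarrow> c \<in> cells C \<Longrightarrow> X closure_of (\<phi> g ` c) = \<phi> g ` (X closure_of c)"
  using homeomorphic_map_closure_of homeo cell_subset by blast

lemma point_free: "g \<in> carrier G \<Longrightarrow> x \<in> topspace X \<Longrightarrow> \<phi> g x = x \<Longrightarrow> g = \<one>"
  using free unfolding free_action_def by blast

text \<open>A generic \<open>K\<close> covers the interval and the square at once. The fixed point
  may lie on the frontier of the cell, which is harmless because freeness is assumed at every point
  of the space.\<close>

lemma convex_cell_free:
  fixes K :: "'a::euclidean_space set"
  assumes K: "compact K" "convex K" "K \<noteq> {}"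
    and c: "homeomorphic_map (top_of_set K) (subtopology X (X closure_of c)) f" "c \<in> cells C"
    and g: "g \<in> carrier G" "\<phi> g ` c = c"
  shows "g = \<one>"
proof -
  have "\<phi> g ` (X closure_of c) \<subseteq> X closure_of c" using closure_act[OF g(1) c(2)] g(2) by simp
  then obtain x where "x \<in> topspace X" "\<phi> g x = x"
    using convex_cell_fixed_point[OF K c(1) homeomorphic_imp_continuous_map[OF homeo[OF g(1)]]]
    by blast
  then show ?thesis using point_free g by blast
qed

lemma edge_free: "g \<in> carrier G \<Longrightarrow> e \<in> edges C \<Longrightarrow> \<phi> g ` e = e \<Longrightarrow> g = \<one>"
  by (rule convex_cell_free[of "{-1..1}" e "chi1 C e"]) (simp_all add: edge_char edge_cell)

lemma square_free: "g \<in> carrier G \<Longrightarrow> q \<in> squares C \<Longrightarrow> \<phi> g ` q = q \<Longrightarrow> g = \<one>"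
  by (rule convex_cell_free[of "{-1..1} \<times> {-1..1}" q "chi2 C q"])
    (simp_all add: square_char square_cell compact_Times convex_Times)

text \<open>A vertex in the closure of an edge is not in the open edge, so it is one of the ends.
  This is the existence half of the definite description in \<open>cubical_act\<close>; the
  uniqueness half is injectivity of \<open>chi1\<close>.\<close>

lemma end_exists:
  assumes g: "g \<in> carrier G" and e: "e \<in> edges C" and \<epsilon>: "\<epsilon> \<in> {-1, 1}"
  obtains \<epsilon>' where "\<epsilon>' \<in> {-1, 1}" "chi1 C (\<phi> g ` e) \<epsilon>' = \<phi> g (chi1 C e \<epsilon>)"
proof -
  let ?v = "\<phi> g (chi1 C e \<epsilon>)"
  have v: "?v \<in> verts C" using vert_act[OF g chi1_vert[OF e \<epsilon>]] .
  have e': "\<phi> g ` e \<in> edges C" using edge_act[OF g e] .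
  have "?v \<notin> \<phi> g ` e"
    using cells_disjoint[OF vert_cell[OF v] edge_cell[OF e']] edge_not_singleton[OF e'] by blast
  moreover have "chi1 C e \<epsilon> \<in> X closure_of e" using closure_edge_ends[OF e] \<epsilon> by blast
  then have "?v \<in> X closure_of (\<phi> g ` e)" using closure_act[OF g edge_cell[OF e]] by blast
  ultimately have "?v \<in> chi1 C (\<phi> g ` e) ` {-1, 1}" using closure_edge_ends[OF e'] by blast
  then show ?thesis using that by force
qed

text \<open>Replaces the definite description by any admissible witness, so that the action laws
  need only exhibit one.\<close>

lemma act_EndOcc:
  assumes g: "g \<in> carrier G" and e: "e \<in> edges C" and \<epsilon>': "\<epsilon>' \<in> {-1, 1}"
    and eq: "chi1 C (\<phi> g ` e) \<epsilon>' = \<phi> g (chi1 C e \<epsilon>)"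
  shows "cubical_act C \<phi> g (EndOcc e \<epsilon>) = EndOcc (\<phi> g ` e) \<epsilon>'"
proof -
  have "\<delta> = \<epsilon>'" if "\<delta> \<in> {-1, 1}" "chi1 C (\<phi> g ` e) \<delta> = \<phi> g (chi1 C e \<epsilon>)" for \<delta>
    by (rule inj_onD[OF chi1_inj[OF edge_act[OF g e]]]) (use that eq \<epsilon>' in auto)
  then have "(THE \<delta>. \<delta> \<in> {-1, 1} \<and> chi1 C (\<phi> g ` e) \<delta> = \<phi> g (chi1 C e \<epsilon>)) = \<epsilon>'"
    using \<epsilon>' eq by (intro the_equality) blast+
  then show ?thesis by simp
qed

text \<open>A point of the open side goes into an edge, and edges are not squares, so its image is
  on the frontier of the image square and hence in some closed side. It is not a vertex, so it lies
  in the open side itself, and open edges with a common point are equal.\<close>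

lemma side_exists:
  assumes g: "g \<in> carrier G" and q: "q \<in> squares C" and j: "j \<in> {1, 2}" and \<epsilon>: "\<epsilon> \<in> {-1, 1}"
  obtains j' \<epsilon>' where "j' \<in> {1, 2}" "\<epsilon>' \<in> {-1, 1}"
    "chi2 C (\<phi> g ` q) ` open_side j' \<epsilon>' = \<phi> g ` chi2 C q ` open_side j \<epsilon>"
proof -
  define s where "s = chi2 C q ` open_side j \<epsilon>"
  have s: "s \<in> edges C" using side_edge(1)[OF q j \<epsilon>] by (simp add: s_def)
  have s': "\<phi> g ` s \<in> edges C" using edge_act[OF g s] .
  have q': "\<phi> g ` q \<in> squares C" using square_act[OF g q] .
  obtain x where x: "x \<in> s" using edge_image[OF s] by fastforce
  have "X closure_of s \<subseteq> X closure_of q"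
    using closure_square_sides[OF q] j \<epsilon> unfolding s_def by blast
  then have "x \<in> X closure_of q"
    using x closure_of_subset[OF cell_subset[OF edge_cell[OF s]]] by blast
  then have "\<phi> g x \<in> X closure_of (\<phi> g ` q)" using closure_act[OF g square_cell[OF q]] by blast
  moreover have "\<phi> g x \<notin> \<phi> g ` q"
    using cells_disjoint[OF edge_cell[OF s'] square_cell[OF q']] edge_not_square[OF s' q'] x by blast
  ultimately obtain j' \<epsilon>' where j': "j' \<in> {1, 2}" "\<epsilon>' \<in> {-1, 1}"
      "\<phi> g x \<in> X closure_of (chi2 C (\<phi> g ` q) ` open_side j' \<epsilon>')"
    using closure_square_sides[OF q'] by blast
  define r where "r = chi2 C (\<phi> g ` q) ` open_side j' \<epsilon>'"
  have r: "r \<in> edges C" using side_edge(1)[OF q' j'(1,2)] by (simp add: r_def)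
  have "\<phi> g x \<notin> chi1 C r ` {-1, 1}"
  proof
    assume "\<phi> g x \<in> chi1 C r ` {-1, 1}"
    then have "\<phi> g x \<in> verts C" using chi1_vert[OF r] by (elim imageE) simp
    then have "\<phi> g ` s = {\<phi> g x}"
      using cells_disjoint[OF edge_cell[OF s'] vert_cell] x by blast
    then show False using edge_not_singleton[OF s'] by blast
  qed
  then have "\<phi> g x \<in> r" using j'(3) closure_edge_ends[OF r] by (simp add: r_def)
  then have "r = \<phi> g ` s" using cells_disjoint[OF edge_cell[OF r] edge_cell[OF s']] x by blast
  then show ?thesis using that j' unfolding r_def s_def by blast
qed

lemma act_SideOcc:
  assumes g: "g \<in> carrier G" and q: "q \<in> squares C" and j': "j' \<in> {1, 2}" and \<epsilon>': "\<epsilon>' \<in> {-1, 1}"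
    and eq: "chi2 C (\<phi> g ` q) ` open_side j' \<epsilon>' = \<phi> g ` chi2 C q ` open_side j \<epsilon>"
  shows "cubical_act C \<phi> g (SideOcc q j \<epsilon>) = SideOcc (\<phi> g ` q) j' \<epsilon>'"
proof -
  have "(THE (i, \<delta>). i \<in> {1, 2} \<and> \<delta> \<in> {-1, 1} \<and>
      chi2 C (\<phi> g ` q) ` open_side i \<delta> = \<phi> g ` chi2 C q ` open_side j \<epsilon>) = (j', \<epsilon>')"
  proof (rule the_equality)
    fix p
    assume "case p of (i, \<delta>) \<Rightarrow> i \<in> {1, 2} \<and> \<delta> \<in> {-1, 1} \<and>
      chi2 C (\<phi> g ` q) ` open_side i \<delta> = \<phi> g ` chi2 C q ` open_side j \<epsilon>"
    then obtain i \<delta> where p: "p = (i, \<delta>)" "i \<in> {1, 2}" "\<delta> \<in> {-1, 1}"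
      "chi2 C (\<phi> g ` q) ` open_side i \<delta> = \<phi> g ` chi2 C q ` open_side j \<epsilon>" by blast
    then show "p = (j', \<epsilon>')"
      using open_side_unique[OF square_act[OF g q] p(2) j' p(3) \<epsilon>'] eq by simp
  qed (use j' \<epsilon>' eq in simp)
  then show ?thesis by (simp only: cubical_act.simps prod.case)
qed

lemma cubical_act_closed:
  assumes g: "g \<in> carrier G" and z: "z \<in> cubical_set C k"
  shows "cubical_act C \<phi> g z \<in> cubical_set C k"
proof (cases k)
  case C0
  then show ?thesis using g z vert_act by auto
next
  case C1
  then show ?thesis using g z edge_act by auto
next
  case C2
  then show ?thesis using g z square_act by auto
next
  case I10
  then obtain e \<epsilon> where e: "e \<in> edges C" "\<epsilon> \<in> {-1, 1}" "z = EndOcc e \<epsilon>" using z by auto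
  obtain \<epsilon>' where "\<epsilon>' \<in> {-1, 1}" "chi1 C (\<phi> g ` e) \<epsilon>' = \<phi> g (chi1 C e \<epsilon>)"
    using end_exists[OF g e(1,2)] .
  then show ?thesis using act_EndOcc[OF g e(1)] edge_act[OF g e(1)] I10 e by auto
next
  case I21
  then obtain q j \<epsilon> where q: "q \<in> squares C" "j \<in> {1, 2}" "\<epsilon> \<in> {-1, 1}" "z = SideOcc q j \<epsilon>"
    using z by auto
  obtain j' \<epsilon>' where "j' \<in> {1, 2}" "\<epsilon>' \<in> {-1, 1}"
    "chi2 C (\<phi> g ` q) ` open_side j' \<epsilon>' = \<phi> g ` chi2 C q ` open_side j \<epsilon>"
    using side_exists[OF g q(1,2,3)] .
  then have "cubical_act C \<phi> g z = SideOcc (\<phi> g ` q) j' \<epsilon>'" "j' \<in> {1, 2}" "\<epsilon>' \<in> {-1, 1}"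
    using act_SideOcc[OF g q(1)] q by blast+
  then show ?thesis using square_act[OF g q(1)] I21 by auto
qed

lemma cubical_act_one:
  assumes z: "z \<in> cubical_set C k"
  shows "cubical_act C \<phi> \<one> z = z"
proof (cases k)
  case C0
  then show ?thesis using z vert_cell cell_subset point_one by fastforce
next
  case C1
  then show ?thesis using z edge_cell cell_subset image_one by fastforce
next
  case C2
  then show ?thesis using z square_cell cell_subset image_one by fastforce
next
  case I10
  then obtain e \<epsilon> where e: "e \<in> edges C" "\<epsilon> \<in> {-1, 1}" "z = EndOcc e \<epsilon>" using z by auto
  have "\<phi> \<one> ` e = e" using image_one cell_subset edge_cell e by blast
  moreover have "chi1 C e \<epsilon> \<in> topspace X" using chi1_vert vert_cell cell_subset e by blast
  ultimately show ?thesis using act_EndOcc[OF one_closed e(1,2), of \<epsilon>] point_one e by simp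
next
  case I21
  then obtain q j \<epsilon> where q: "q \<in> squares C" "j \<in> {1, 2}" "\<epsilon> \<in> {-1, 1}" "z = SideOcc q j \<epsilon>"
    using z by auto
  have "\<phi> \<one> ` q = q" using image_one cell_subset square_cell q by blast
  moreover have "\<phi> \<one> ` chi2 C q ` open_side j \<epsilon> = chi2 C q ` open_side j \<epsilon>"
    using image_one cell_subset edge_cell side_edge(1)[OF q(1-3)] by blast
  ultimately show ?thesis using act_SideOcc[OF one_closed q(1-3), of j \<epsilon>] q by simp
qed

text \<open>For occurrences, the end or side found by applying \<open>h\<close> and then
  \<open>g\<close> also meets the specification for the product, and uniqueness identifies the
  two.\<close>

lemma cubical_act_mult:
  assumes g: "g \<in> carrier G" and h: "h \<in> carrier G" and z: "z \<in> cubical_set C k"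
  shows "cubical_act C \<phi> (g \<otimes> h) z = cubical_act C \<phi> g (cubical_act C \<phi> h z)"
proof (cases k)
  case C0
  then show ?thesis using g h z vert_cell cell_subset point_mult by fastforce
next
  case C1
  then obtain e where "e \<in> edges C" "z = Edge e" using z by auto
  then show ?thesis using image_mult[OF g h cell_subset[OF edge_cell]] by simp
next
  case C2
  then obtain q where "q \<in> squares C" "z = Square q" using z by auto
  then show ?thesis using image_mult[OF g h cell_subset[OF square_cell]] by simp
next
  case I10
  then obtain e \<epsilon> where e: "e \<in> edges C" "\<epsilon> \<in> {-1, 1}" "z = EndOcc e \<epsilon>" using z by auto
  obtain \<delta> where d: "\<delta> \<in> {-1, 1}" "chi1 C (\<phi> h ` e) \<delta> = \<phi> h (chi1 C e \<epsilon>)"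
    using end_exists[OF h e(1,2)] .
  obtain \<zeta> where z: "\<zeta> \<in> {-1, 1}" "chi1 C (\<phi> g ` \<phi> h ` e) \<zeta> = \<phi> g (chi1 C (\<phi> h ` e) \<delta>)"
    using end_exists[OF g edge_act[OF h e(1)] d(1)] .
  have gh: "\<phi> (g \<otimes> h) ` e = \<phi> g ` \<phi> h ` e" using image_mult[OF g h cell_subset[OF edge_cell[OF e(1)]]] .
  have "chi1 C e \<epsilon> \<in> topspace X" using chi1_vert vert_cell cell_subset e by blast
  then have "chi1 C (\<phi> (g \<otimes> h) ` e) \<zeta> = \<phi> (g \<otimes> h) (chi1 C e \<epsilon>)"
    using gh z d point_mult[OF g h] by simp
  then show ?thesis
    using act_EndOcc[OF m_closed[OF g h] e(1) z(1)] act_EndOcc[OF g edge_act[OF h e(1)] z]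
      act_EndOcc[OF h e(1) d] e(3) gh by simp
next
  case I21
  then obtain q j \<epsilon> where q: "q \<in> squares C" "j \<in> {1, 2}" "\<epsilon> \<in> {-1, 1}" "z = SideOcc q j \<epsilon>"
    using z by auto
  obtain i \<delta> where d: "i \<in> {1, 2}" "\<delta> \<in> {-1, 1}"
    "chi2 C (\<phi> h ` q) ` open_side i \<delta> = \<phi> h ` chi2 C q ` open_side j \<epsilon>"
    using side_exists[OF h q(1,2,3)] .
  obtain l \<zeta> where z: "l \<in> {1, 2}" "\<zeta> \<in> {-1, 1}"
    "chi2 C (\<phi> g ` \<phi> h ` q) ` open_side l \<zeta> = \<phi> g ` chi2 C (\<phi> h ` q) ` open_side i \<delta>"
    using side_exists[OF g square_act[OF h q(1)] d(1,2)] .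
  have gh: "\<phi> (g \<otimes> h) ` q = \<phi> g ` \<phi> h ` q" using image_mult[OF g h cell_subset[OF square_cell[OF q(1)]]] .
  have "\<phi> (g \<otimes> h) ` chi2 C q ` open_side j \<epsilon> = \<phi> g ` \<phi> h ` chi2 C q ` open_side j \<epsilon>"
    using image_mult[OF g h cell_subset[OF edge_cell[OF side_edge(1)[OF q(1-3)]]]] .
  then have "chi2 C (\<phi> (g \<otimes> h) ` q) ` open_side l \<zeta> = \<phi> (g \<otimes> h) ` chi2 C q ` open_side j \<epsilon>"
    using gh z d by metis
  then show ?thesis
    using act_SideOcc[OF m_closed[OF g h] q(1) z(1,2)] act_SideOcc[OF g square_act[OF h q(1)] z]
      act_SideOcc[OF h q(1) d] q(4) gh by metis
qed

text \<open>The action on occurrences lies over the action on cells, so a fixed occurrence has a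
  fixed edge or square.\<close>

lemma cubical_act_free:
  assumes g: "g \<in> carrier G" and z: "z \<in> cubical_set C k" and eq: "cubical_act C \<phi> g z = z"
  shows "g = \<one>"
proof (cases k)
  case C0
  then show ?thesis using g z eq vert_cell cell_subset point_free by fastforce
next
  case C1
  then show ?thesis using g z eq edge_free by auto
next
  case C2
  then show ?thesis using g z eq square_free by auto
next
  case I10
  then show ?thesis using g z eq edge_free by auto
next
  case I21
  then show ?thesis using g z eq square_free by (auto split: prod.splits)
qed

lemma cubical_q10_act:
  assumes g: "g \<in> carrier G" and z: "z \<in> cubical_set C I10"
  shows "cubical_q10 C (cubical_act C \<phi> g z) = cubical_act C \<phi> g (cubical_q10 C z)"
proof -
  obtain e \<epsilon> where e: "e \<in> edges C" "\<epsilon> \<in> {-1, 1}" "z = EndOcc e \<epsilon>" using z by auto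
  obtain \<epsilon>' where "\<epsilon>' \<in> {-1, 1}" "chi1 C (\<phi> g ` e) \<epsilon>' = \<phi> g (chi1 C e \<epsilon>)"
    using end_exists[OF g e(1,2)] .
  then show ?thesis using act_EndOcc[OF g e(1)] e by simp
qed

lemma cubical_q21_act:
  assumes g: "g \<in> carrier G" and z: "z \<in> cubical_set C I21"
  shows "cubical_q21 C (cubical_act C \<phi> g z) = cubical_act C \<phi> g (cubical_q21 C z)"
proof -
  obtain q j \<epsilon> where q: "q \<in> squares C" "j \<in> {1, 2}" "\<epsilon> \<in> {-1, 1}" "z = SideOcc q j \<epsilon>"
    using z by auto
  obtain j' \<epsilon>' where d: "j' \<in> {1, 2}" "\<epsilon>' \<in> {-1, 1}"
    "chi2 C (\<phi> g ` q) ` open_side j' \<epsilon>' = \<phi> g ` chi2 C q ` open_side j \<epsilon>"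
    using side_exists[OF g q(1,2,3)] .
  show ?thesis unfolding q(4) act_SideOcc[OF g q(1) d] using d(3) by simp
qed

lemma cubical_p10_act:
  "z \<in> cubical_set C I10 \<Longrightarrow> cubical_p10 (cubical_act C \<phi> g z) = cubical_act C \<phi> g (cubical_p10 z)"
  by auto

lemma cubical_p21_act:
  "z \<in> cubical_set C I21 \<Longrightarrow> cubical_p21 (cubical_act C \<phi> g z) = cubical_act C \<phi> g (cubical_p21 z)"
  by (auto split: prod.split)

end

lemma cubical_p10_closed: "z \<in> cubical_set C I10 \<Longrightarrow> cubical_p10 z \<in> cubical_set C C1"
  and cubical_p21_closed: "z \<in> cubical_set C I21 \<Longrightarrow> cubical_p21 z \<in> cubical_set C C2"
  by auto

lemma (in regular_complex) cubical_q10_closed: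
    "z \<in> cubical_set C I10 \<Longrightarrow> cubical_q10 C z \<in> cubical_set C C0"
  using chi1_vert by auto

lemma (in regular_complex) cubical_q21_closed:
  assumes "z \<in> cubical_set C I21"
  shows "cubical_q21 C z \<in> cubical_set C C1"
proof -
  obtain q j \<epsilon> where q: "q \<in> squares C" "j \<in> {1, 2}" "\<epsilon> \<in> {-1, 1}" "z = SideOcc q j \<epsilon>"
    using assms by auto
  show ?thesis using side_edge(1)[OF q(1-3)] q(4) by simp
qed

section \<open>Maps of profinite completions\<close>

text \<open>\<open>h\<close> maps the preimage of \<open>M\<close> into \<open>M\<close>, where it
  is absorbed. This evaluates \<open>profinite_map\<close> on the thread of
  \<open>g\<close>.\<close>

lemma hom_image_r_coset:
  assumes "group G" "group H" and h: "h \<in> hom G H" and M: "subgroup M H" and g: "g \<in> carrier G"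
  shows "M <#>\<^bsub>H\<^esub> h ` ({g \<in> carrier G. h g \<in> M} #>\<^bsub>G\<^esub> g) = M #>\<^bsub>H\<^esub> h g"
proof -
  interpret G: group G by fact
  interpret H: group H by fact
  interpret hom: group_hom G H h using h by unfold_locales
  let ?K = "{g \<in> carrier G. h g \<in> M}"
  have Mc: "M \<subseteq> carrier H" using M subgroup.subset by blast
  have hg: "h g \<in> carrier H" using g by simp
  show ?thesis
  proof (rule equalityI; rule subsetI)
    fix x assume "x \<in> M <#>\<^bsub>H\<^esub> h ` (?K #>\<^bsub>G\<^esub> g)"
    then obtain m k where mk: "m \<in> M" "k \<in> carrier G" "h k \<in> M"
      and x: "x = m \<otimes>\<^bsub>H\<^esub> h (k \<otimes>\<^bsub>G\<^esub> g)"
      by (auto simp: set_mult_def r_coset_def)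
    have "x = (m \<otimes>\<^bsub>H\<^esub> h k) \<otimes>\<^bsub>H\<^esub> h g"
      using mk Mc g x by (simp add: H.m_assoc subsetD)
    moreover have "m \<otimes>\<^bsub>H\<^esub> h k \<in> M" using mk M by (simp add: subgroup.m_closed)
    ultimately show "x \<in> M #>\<^bsub>H\<^esub> h g" by (auto simp: r_coset_def)
  next
    fix x assume "x \<in> M #>\<^bsub>H\<^esub> h g"
    then obtain m where m: "m \<in> M" "x = m \<otimes>\<^bsub>H\<^esub> h g" by (auto simp: r_coset_def)
    have "\<one>\<^bsub>G\<^esub> \<in> ?K" using M subgroup.one_closed by fastforce
    then have "g \<in> ?K #>\<^bsub>G\<^esub> g" using g unfolding r_coset_def by force
    then show "x \<in> M <#>\<^bsub>H\<^esub> h ` (?K #>\<^bsub>G\<^esub> g)" using m unfolding set_mult_def by blast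
  qed
qed

text \<open>The map \<open>c -> M h(c)\<close> sends cosets of the preimage injectively to cosets of
  \<open>M\<close>, so finite index pulls back. Hence the coordinate that
  \<open>profinite_map\<close> reads is a genuine one.\<close>

lemma finite_index_normal_vimage:
  assumes "group G" "group H" and h: "h \<in> hom G H" and M: "M \<in> finite_index_normal H"
  shows "{g \<in> carrier G. h g \<in> M} \<in> finite_index_normal G" (is "?K \<in> _")
proof -
  interpret G: group G by fact
  interpret H: group H by fact
  interpret hom: group_hom G H h using h by unfold_locales
  interpret M: normal M H using M by (rule H.finite_index_normal_normal)
  have K: "subgroup ?K G"
    by (rule G.subgroupI) (auto intro: exI[of _ "\<one>\<^bsub>G\<^esub>"])
  have "?K \<lhd> G"
    unfolding G.normal_inv_iff using K M.inv_op_closed2 by simp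
  moreover have "finite (rcosets\<^bsub>G\<^esub> ?K)"
  proof (rule inj_on_finite)
    show "finite (rcosets\<^bsub>H\<^esub> M)" using M by (simp add: finite_index_normal_def)
    let ?f = "\<lambda>c. M <#>\<^bsub>H\<^esub> h ` c"
    note f = hom_image_r_coset[OF assms(1,2) h M.subgroup_axioms]
    show "?f ` (rcosets\<^bsub>G\<^esub> ?K) \<subseteq> rcosets\<^bsub>H\<^esub> M"
      using f H.rcosetsI[OF M.subset] by (auto simp: RCOSETS_def[of G])
    show "inj_on ?f (rcosets\<^bsub>G\<^esub> ?K)"
    proof (rule inj_onI)
      fix c d assume cd: "c \<in> rcosets\<^bsub>G\<^esub> ?K" "d \<in> rcosets\<^bsub>G\<^esub> ?K" "?f c = ?f d"
      then obtain x y where xy: "x \<in> carrier G" "y \<in> carrier G" "c = ?K #>\<^bsub>G\<^esub> x" "d = ?K #>\<^bsub>G\<^esub> y"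
        by (auto simp: RCOSETS_def)
      then have "M #>\<^bsub>H\<^esub> h x = M #>\<^bsub>H\<^esub> h y" using f cd(3) by simp
      then have "h x \<in> M #>\<^bsub>H\<^esub> h y"
        using H.rcos_self[OF hom.hom_closed[OF xy(1)] M.subgroup_axioms] by simp
      then have "h x \<otimes>\<^bsub>H\<^esub> inv\<^bsub>H\<^esub> h y \<in> M"
        using M.rcos_module_imp[OF H.is_group hom.hom_closed[OF xy(2)]] by blast
      then have "x \<otimes>\<^bsub>G\<^esub> inv\<^bsub>G\<^esub> y \<in> ?K" using xy by simp
      then have "x \<in> ?K #>\<^bsub>G\<^esub> y"
        using subgroup.rcos_module_rev[OF K G.is_group xy(2,1)] by blast
      then show "c = d" using G.repr_independence[OF _ xy(2) K] xy(3,4) by simp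
    qed
  qed
  ultimately show ?thesis by (simp add: finite_index_normal_def)
qed

lemma (in group) profinite_coordinate_continuous:
  assumes "N \<in> finite_index_normal G"
  shows "continuous_map (profinite_top G) (discrete_topology (carrier (G Mod N))) (\<lambda>x. x N)"
  unfolding profinite_top_def
  by (rule continuous_map_from_subtopology) (rule continuous_map_product_projection[OF assms])

text \<open>The coordinate at \<open>N\<close> of a conjugate depends only on the coordinate at
  \<open>N\<close>, through a map of discrete spaces; so each coordinate is continuous.\<close>

lemma (in group) Inn_continuous:
  assumes u: "u \<in> carrier (profinite_group G)"
  shows "continuous_map (profinite_top G) (profinite_top G) (Inn (profinite_group G) u)"
proof -
  interpret P: group "profinite_group G" by (rule group_profinite)
  let ?P = "profinite_group G" and ?F = "finite_index_normal G"
  have top: "topspace (profinite_top G) = carrier ?P" by (simp add: profinite_group_def)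
  have closed: "Inn ?P u x \<in> carrier ?P" if "x \<in> carrier ?P" for x
    using that u by (simp add: Inn_def)
  have coord: "continuous_map (profinite_top G) (discrete_topology (carrier (G Mod N)))
      (\<lambda>x. Inn ?P u x N)" if N: "N \<in> ?F" for N
  proof -
    interpret Q: group "G Mod N"
      by (rule normal.factorgroup_is_group[OF finite_index_normal_normal[OF N]])
    have c: "w N \<in> carrier (G Mod N)" if "w \<in> carrier ?P" for w
      using profinite_coset[OF that N] by (auto simp: carrier_FactGroup)
    let ?f = "\<lambda>c. u N \<otimes>\<^bsub>G Mod N\<^esub> c \<otimes>\<^bsub>G Mod N\<^esub> (inv\<^bsub>?P\<^esub> u) N"
    have "continuous_map (profinite_top G) (discrete_topology (carrier (G Mod N))) (?f \<circ> (\<lambda>x. x N))"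
      using c[OF u] c[OF P.inv_closed[OF u]] Q.m_closed
      by (intro continuous_map_compose[OF profinite_coordinate_continuous[OF N]])
        (simp del: mult_FactGroup)
    then show ?thesis
      by (rule continuous_map_eq) (use N u top in \<open>simp add: Inn_def profinite_mult\<close>)
  qed
  have "Inn ?P u x \<in> extensional ?F" if "x \<in> carrier ?P" for x
    using closed[OF that] profinite_carrier_iff by blast
  then have cont: "continuous_map (profinite_top G)
      (product_topology (\<lambda>N. discrete_topology (carrier (G Mod N))) ?F) (Inn ?P u)"
    unfolding continuous_map_componentwise using coord top by (auto simp: image_subset_iff)
  \<comment> \<open>\<open>S\<close> hides the compatibility condition on threads; membership in it
    is already known, because conjugation preserves the carrier.\<close>
  obtain S where S: "profinite_top G =
      subtopology (product_topology (\<lambda>N. discrete_topology (carrier (G Mod N))) ?F) S"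
    using profinite_top_def by blast
  have "Inn ?P u x \<in> S" if "x \<in> topspace (profinite_top G)" for x
    using closed[of x] that by (simp add: top[symmetric]) (simp add: S)
  then have "continuous_map (profinite_top G)
      (subtopology (product_topology (\<lambda>N. discrete_topology (carrier (G Mod N))) ?F) S) (Inn ?P u)"
    using cont by (auto simp: continuous_map_in_subtopology)
  then show ?thesis by (simp flip: S)
qed

text \<open>Density is used one coordinate at a time: some embedded \<open>g\<close> shares with
  \<open>x\<close> all that matters at \<open>M\<close>, and at this \<open>g\<close> both sides are
  the coset \<open>M h(g)\<close>.\<close>

lemma (in cofinal_group) profinite_map_unique:
  assumes "group H" and h: "h \<in> hom G H"
    and \<theta>: "continuous_map (profinite_top G) (profinite_top H) \<theta>"
    and emb: "\<And>g. g \<in> carrier G \<Longrightarrow> \<theta> (profinite_embed g) = group.profinite_embed H (h g)"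
    and x: "x \<in> carrier (profinite_group G)"
  shows "\<theta> x = profinite_map G H h x"
proof (rule extensionalityI[of _ "finite_index_normal H"])
  interpret H: group H by fact
  have top: "topspace (profinite_top G) = carrier (profinite_group G)"
    "topspace (profinite_top H) = carrier (profinite_group H)"
    by (simp_all add: profinite_group_def)
  have "\<theta> x \<in> carrier (profinite_group H)" using \<theta> x top by (auto simp: continuous_map_def)
  then show "\<theta> x \<in> extensional (finite_index_normal H)" using H.profinite_carrier_iff by blast
  show "profinite_map G H h x \<in> extensional (finite_index_normal H)" by (simp add: profinite_map_def)
  fix M assume M: "M \<in> finite_index_normal H"
  let ?K = "{g \<in> carrier G. h g \<in> M}"
  have K: "?K \<in> finite_index_normal G"
    using finite_index_normal_vimage[OF is_group assms(1) h M] .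
  \<comment> \<open>The first constraint fixes the \<open>M\<close>-coordinate of
    \<open>\<theta>\<close>, the second the only coordinate that \<open>profinite_map\<close> reads
    at \<open>M\<close>. Each is open because coordinates are continuous into discrete
    spaces.\<close>
  define U where "U = {y \<in> topspace (profinite_top G). \<theta> y M \<in> {\<theta> x M}} \<inter>
    {y \<in> topspace (profinite_top G). y ?K \<in> {x ?K}}"
  have cM: "continuous_map (profinite_top G) (discrete_topology (carrier (H Mod M))) (\<lambda>y. \<theta> y M)"
    using continuous_map_compose[OF \<theta> H.profinite_coordinate_continuous[OF M]] by (simp add: o_def)
  have "openin (profinite_top G) U"
    unfolding U_def
    using x top cM profinite_coordinate_continuous[OF K]
    by (intro openin_Int openin_continuous_map_preimage[OF cM]
        openin_continuous_map_preimage[OF profinite_coordinate_continuous[OF K]])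
      (auto simp: continuous_map_def)
  moreover have "x \<in> U" using x top by (simp add: U_def)
  ultimately obtain g where g: "g \<in> carrier G" "profinite_embed g \<in> U"
    using profinite_embed_dense by blast
  have "\<theta> x M = \<theta> (profinite_embed g) M" using g(2) by (simp add: U_def)
  also have "\<dots> = M #>\<^bsub>H\<^esub> h g" using emb[OF g(1)] M by (simp add: H.profinite_embed_def)
  also have "\<dots> = M <#>\<^bsub>H\<^esub> h ` (?K #> g)"
    using hom_image_r_coset[OF is_group assms(1) h H.finite_index_normal_subgroup[OF M] g(1)] by simp
  also have "?K #> g = x ?K" using g(2) K by (simp add: U_def profinite_embed_def)
  finally show "\<theta> x M = profinite_map G H h x M" using M by (simp add: profinite_map_def)
qed


section \<open>Completed residual complexes\<close>

lemma (in free_set_map) completion_map_point: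
  assumes "z \<in> Z"
  shows "completion_map \<N> p (Z.point z) = W.point (p z)"
proof -
  interpret P: group "profinite_group G" by (rule Z.group_profinite)
  show ?thesis
    using completion_map_move_point[OF P.one_closed assms] assms map_closed
    by (simp add: Z.move_one_point W.move_one_point)
qed

locale completed_action = complex_action G C \<phi> + cofinal_group G \<N>
  for G :: "('g, 'b) monoid_scheme" (structure) and C :: "'p square_complex" and \<phi> \<N>
begin

abbreviation R :: "('g set \<Rightarrow> 'p relt set) residual_complex" where
  "R \<equiv> completed_residual_complex G \<N> C \<phi>"

abbreviation space :: "rsort \<Rightarrow> ('g set \<Rightarrow> 'p relt set) set" where
  "space k \<equiv> topspace (component R k)"

abbreviation original :: "rsort \<Rightarrow> ('g set \<Rightarrow> 'p relt set) set" where
  "original \<equiv> original_points G \<N> C \<phi>"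

abbreviation pt :: "'p relt \<Rightarrow> 'g set \<Rightarrow> 'p relt set" where
  "pt \<equiv> completion_point G \<N> (cubical_act C \<phi>)"

abbreviation mv :: "('g set \<Rightarrow> 'g set) \<Rightarrow> ('g set \<Rightarrow> 'p relt set) \<Rightarrow> 'g set \<Rightarrow> 'p relt set" where
  "mv \<equiv> completion_act \<N> (cubical_act C \<phi>)"

lemma component_eq: "component R k = completion G \<N> (cubical_act C \<phi>) (cubical_set C k)"
  by (simp add: completed_residual_complex_def cubical_residual_complex_def Let_def)

lemma structure_maps_eq:
  "p10 R = completion_map \<N> cubical_p10" "q10 R = completion_map \<N> (cubical_q10 C)"
  "p21 R = completion_map \<N> cubical_p21" "q21 R = completion_map \<N> (cubical_q21 C)"
  by (simp_all add: completed_residual_complex_def cubical_residual_complex_def Let_def)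

lemma original_eq: "original k = pt ` cubical_set C k"
  by (simp add: original_points_def cubical_residual_complex_def)

text \<open>The locale asks for the action laws pointwise and only on the set, unlike
  \<open>group_action\<close>, whose maps are \<open>undefined\<close> outside it. So the single
  function \<open>cubical_act\<close> can serve all five components.\<close>

lemma free_set: "free_set_action G \<N> (cubical_act C \<phi>) (cubical_set C k)"
  by unfold_locales
    (fact cubical_act_closed cubical_act_one cubical_act_mult cubical_act_free)+

lemma free_set_map_p10:
  "free_set_map G \<N> (cubical_act C \<phi>) (cubical_set C I10) (cubical_set C C1) cubical_p10"
  by (intro free_set_map.intro free_set free_set_map_axioms.intro cubical_p10_closed cubical_p10_act)

lemma free_set_map_q10:
  "free_set_map G \<N> (cubical_act C \<phi>) (cubical_set C I10) (cubical_set C C0) (cubical_q10 C)"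
  by (intro free_set_map.intro free_set free_set_map_axioms.intro cubical_q10_closed cubical_q10_act)

lemma free_set_map_p21:
  "free_set_map G \<N> (cubical_act C \<phi>) (cubical_set C I21) (cubical_set C C2) cubical_p21"
  by (intro free_set_map.intro free_set free_set_map_axioms.intro cubical_p21_closed cubical_p21_act)

lemma free_set_map_q21:
  "free_set_map G \<N> (cubical_act C \<phi>) (cubical_set C I21) (cubical_set C C1) (cubical_q21 C)"
  by (intro free_set_map.intro free_set free_set_map_axioms.intro cubical_q21_closed cubical_q21_act)

lemmas space_move = free_set_action.move_closed[OF free_set, folded component_eq]
lemmas space_point = free_set_action.point_closed[OF free_set, folded component_eq]
lemmas space_move_mult = free_set_action.move_mult[OF free_set, folded component_eq]
lemmas space_move_one = free_set_action.move_one[OF free_set, folded component_eq]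
lemmas space_eq_move_point = free_set_action.completed_eq_move_point[OF free_set, folded component_eq]

lemmas structure_maps_closed =
  free_set_map.completion_map_closed[OF free_set_map_p10, folded component_eq structure_maps_eq]
  free_set_map.completion_map_closed[OF free_set_map_q10, folded component_eq structure_maps_eq]
  free_set_map.completion_map_closed[OF free_set_map_p21, folded component_eq structure_maps_eq]
  free_set_map.completion_map_closed[OF free_set_map_q21, folded component_eq structure_maps_eq]

lemmas structure_maps_point =
  free_set_map.completion_map_point[OF free_set_map_p10, folded structure_maps_eq]
  free_set_map.completion_map_point[OF free_set_map_q10, folded structure_maps_eq]
  free_set_map.completion_map_point[OF free_set_map_p21, folded structure_maps_eq]
  free_set_map.completion_map_point[OF free_set_map_q21, folded structure_maps_eq]

lemmas structure_maps_original_iff =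
  free_set_map.completion_map_original_iff[OF free_set_map_p10,
    folded component_eq structure_maps_eq original_eq]
  free_set_map.completion_map_original_iff[OF free_set_map_q10,
    folded component_eq structure_maps_eq original_eq]
  free_set_map.completion_map_original_iff[OF free_set_map_p21,
    folded component_eq structure_maps_eq original_eq]
  free_set_map.completion_map_original_iff[OF free_set_map_q21,
    folded component_eq structure_maps_eq original_eq]

end


section \<open>Isomorphisms between completed residual complexes\<close>

locale residual_map =
  A: completed_action G C \<phi> \<N> + B: completed_action H D \<psi> \<M>
  for G :: "('g, 'b) monoid_scheme" and C :: "'p square_complex" and \<phi> \<N>
    and H :: "('h, 'c) monoid_scheme" and D :: "'q square_complex" and \<psi> \<M> +
  fixes F :: "rsort \<Rightarrow> ('g set \<Rightarrow> 'p relt set) \<Rightarrow> ('h set \<Rightarrow> 'q relt set)"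
  assumes iso: "residual_isomorphism A.R B.R F"
begin

lemma F_bij: "bij_betw (F k) (A.space k) (B.space k)"
  using iso homeomorphic_imp_injective_map homeomorphic_imp_surjective_map
  unfolding residual_isomorphism_def bij_betw_def by blast

lemma F_closed: "y \<in> A.space k \<Longrightarrow> F k y \<in> B.space k"
  using F_bij bij_betwE by blast

lemma F_commute:
  "y \<in> A.space I10 \<Longrightarrow> F C1 (p10 A.R y) = p10 B.R (F I10 y)"
  "y \<in> A.space I10 \<Longrightarrow> F C0 (q10 A.R y) = q10 B.R (F I10 y)"
  "y \<in> A.space I21 \<Longrightarrow> F C2 (p21 A.R y) = p21 B.R (F I21 y)"
  "y \<in> A.space I21 \<Longrightarrow> F C1 (q21 A.R y) = q21 B.R (F I21 y)"
  using iso unfolding residual_isomorphism_def by blast+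

text \<open>\<open>F\<close> commutes with the structure maps, so being sent into the translate by
  \<open>u\<close> passes from a cell to its occurrences and on to its faces, in both directions.
  Connectedness spreads it from the vertex \<open>v\<close>.\<close>

lemma F_original:
  assumes conn: "connected_complex C" and u: "u \<in> carrier (profinite_group H)"
    and v: "v \<in> verts C" "F C0 (A.pt (Vert v)) \<in> B.mv u ` B.original C0"
  shows "F k ` A.original k \<subseteq> B.mv u ` B.original k"
proof -
  define good where "good k z \<longleftrightarrow> F k (A.pt z) \<in> B.mv u ` B.original k" for k z
  have pt: "A.pt z \<in> A.space k" if "z \<in> cubical_set C k" for z k
    using that by (rule A.space_point)
  have p10: "good C1 (cubical_p10 z) \<longleftrightarrow> good I10 z"
    and q10: "good C0 (cubical_q10 C z) \<longleftrightarrow> good I10 z" if z: "z \<in> cubical_set C I10" for z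
    using B.structure_maps_original_iff(1,2)[OF u F_closed[OF pt[OF z]]]
    unfolding good_def A.structure_maps_point(1,2)[OF z, symmetric] F_commute(1,2)[OF pt[OF z]]
    by simp_all
  have p21: "good C2 (cubical_p21 z) \<longleftrightarrow> good I21 z"
    and q21: "good C1 (cubical_q21 C z) \<longleftrightarrow> good I21 z" if z: "z \<in> cubical_set C I21" for z
    using B.structure_maps_original_iff(3,4)[OF u F_closed[OF pt[OF z]]]
    unfolding good_def A.structure_maps_point(3,4)[OF z, symmetric] F_commute(3,4)[OF pt[OF z]]
    by simp_all
  \<comment> \<open>The induction takes one predicate on tags, while \<open>good\<close> also
    depends on the component. A tag belongs to at most one component, so the quantifier over
    \<open>k\<close> merely selects it.\<close>
  define P where "P z \<longleftrightarrow> (\<forall>k. z \<in> cubical_set C k \<longrightarrow> good k z)" for z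
  have PV: "P (Vert w) \<longleftrightarrow> good C0 (Vert w)" if "w \<in> verts C" for w
    unfolding P_def
  proof
    assume "good C0 (Vert w)"
    show "\<forall>k. Vert w \<in> cubical_set C k \<longrightarrow> good k (Vert w)"
    proof (intro allI impI)
      fix k assume "Vert w \<in> cubical_set C k"
      then show "good k (Vert w)" using \<open>good C0 (Vert w)\<close> by (cases k) auto
    qed
  qed (use that in auto)
  have PE: "P (Edge e) \<longleftrightarrow> good C1 (Edge e)" if "e \<in> edges C" for e
    unfolding P_def
  proof
    assume "good C1 (Edge e)"
    show "\<forall>k. Edge e \<in> cubical_set C k \<longrightarrow> good k (Edge e)"
    proof (intro allI impI)
      fix k assume "Edge e \<in> cubical_set C k"
      then show "good k (Edge e)" using \<open>good C1 (Edge e)\<close> by (cases k) auto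
    qed
  qed (use that in auto)
  have PS: "P (Square q) \<longleftrightarrow> good C2 (Square q)" if "q \<in> squares C" for q
    unfolding P_def
  proof
    assume "good C2 (Square q)"
    show "\<forall>k. Square q \<in> cubical_set C k \<longrightarrow> good k (Square q)"
    proof (intro allI impI)
      fix k assume "Square q \<in> cubical_set C k"
      then show "good k (Square q)" using \<open>good C2 (Square q)\<close> by (cases k) auto
    qed
  qed (use that in auto)
  have P: "P z" if z: "z \<in> cell_tags C" for z
  proof (rule A.connected_cells_induct[OF conn _ _ _ _ z])
    show "P (Edge e) \<longleftrightarrow> P (Vert (chi1 C e \<epsilon>))" if "e \<in> edges C" "\<epsilon> \<in> {-1, 1}" for e \<epsilon>
    proof -
      have "EndOcc e \<epsilon> \<in> cubical_set C I10" using that by simp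
      from p10[OF this] q10[OF this] show ?thesis using PE PV A.chi1_vert that by simp
    qed
    show "P (Square q) \<longleftrightarrow> P (Edge (chi2 C q ` open_side j \<epsilon>))"
      if "q \<in> squares C" "j \<in> {1, 2}" "\<epsilon> \<in> {-1, 1}" for q j \<epsilon>
    proof -
      have "SideOcc q j \<epsilon> \<in> cubical_set C I21" using that by simp
      from p21[OF this] q21[OF this] show ?thesis using PS PE A.side_edge(1) that by simp
    qed
    show "Vert v \<in> cell_tags C" using v by (simp add: cell_tags_def)
    show "P (Vert v)" using v PV by (simp add: good_def)
  qed
  \<comment> \<open>Occurrences are not cells and are not reached by the induction; each inherits
    the property from the cell to which it belongs.\<close>
  have "good k z" if z: "z \<in> cubical_set C k" for z
  proof (cases k)
    case I10
    then have "cubical_p10 z \<in> cubical_set C C1" using cubical_p10_closed z by blast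
    then have "good C1 (cubical_p10 z)" using P unfolding cell_tags_def P_def by blast
    then show ?thesis using p10 z I10 by simp
  next
    case I21
    then have "cubical_p21 z \<in> cubical_set C C2" using cubical_p21_closed z by blast
    then have "good C2 (cubical_p21 z)" using P unfolding cell_tags_def P_def by blast
    then show ?thesis using p21 z I21 by simp
  qed (use P z in \<open>auto simp: cell_tags_def P_def\<close>)
  then show ?thesis by (auto simp: A.original_eq good_def)
qed

text \<open>Makes the situation symmetric, so that \<open>F_original\<close> also yields the reverse
  inclusion.\<close>

lemma F_inverse: "residual_map H D \<psi> \<M> G C \<phi> \<N> (\<lambda>k. inv_into (A.space k) (F k))"
proof -
  let ?I = "\<lambda>k. inv_into (A.space k) (F k)"
  have I: "?I k y \<in> A.space k" "F k (?I k y) = y" if "y \<in> B.space k" for k y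
    using F_bij[of k] that by (auto simp: bij_betw_def inv_into_into f_inv_into_f)
  have IF: "?I k (F k x) = x" if "x \<in> A.space k" for k x
    using F_bij[of k] that by (auto simp: bij_betw_def)
  have "homeomorphic_map (component B.R k) (component A.R k) (?I k)" for k
  proof -
    have "homeomorphic_map (component A.R k) (component B.R k) (F k)"
      using iso unfolding residual_isomorphism_def by blast
    then obtain f' where f': "homeomorphic_maps (component A.R k) (component B.R k) (F k) f'"
      using homeomorphic_map_maps by blast
    \<comment> \<open>The continuous inverse and \<open>inv_into\<close> agree only on the target
      space, which is enough for \<open>homeomorphic_map_eq\<close>.\<close>
    have "f' y = ?I k y" if "y \<in> B.space k" for y
      using f' that IF[of "f' y" k] by (auto simp: homeomorphic_maps_def continuous_map_def Pi_iff)
    moreover have "homeomorphic_map (component B.R k) (component A.R k) f'"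
      using f' homeomorphic_maps_map homeomorphic_maps_sym by blast
    ultimately show ?thesis using homeomorphic_map_eq by blast
  qed
  moreover have "?I C1 (p10 B.R y) = p10 A.R (?I I10 y)" "?I C0 (q10 B.R y) = q10 A.R (?I I10 y)"
    if "y \<in> B.space I10" for y
    using IF[OF A.structure_maps_closed(1)[OF I(1)[OF that]]]
      IF[OF A.structure_maps_closed(2)[OF I(1)[OF that]]] F_commute(1,2)[OF I(1)[OF that]] I(2)[OF that]
    by simp_all
  moreover have "?I C2 (p21 B.R y) = p21 A.R (?I I21 y)" "?I C1 (q21 B.R y) = q21 A.R (?I I21 y)"
    if "y \<in> B.space I21" for y
    using IF[OF A.structure_maps_closed(3)[OF I(1)[OF that]]]
      IF[OF A.structure_maps_closed(4)[OF I(1)[OF that]]] F_commute(3,4)[OF I(1)[OF that]] I(2)[OF that]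
    by simp_all
  ultimately have "residual_isomorphism B.R A.R ?I"
    unfolding residual_isomorphism_def by blast
  then show ?thesis
    by (intro residual_map.intro B.completed_action_axioms A.completed_action_axioms
        residual_map_axioms.intro)
qed

lemma rigidity:
  assumes connected: "connected_complex C" "connected_complex D"
    and rf: "residually_finite G" "residually_finite H"
    and \<eta>: "\<eta> \<in> iso (profinite_group G) (profinite_group H)"
    and cont: "continuous_map (profinite_top G) (profinite_top H) \<eta>"
    and equivariant: "\<And>k \<gamma> y. \<gamma> \<in> carrier (profinite_group G) \<Longrightarrow> y \<in> A.space k \<Longrightarrow>
        F k (A.mv \<gamma> y) = B.mv (\<eta> \<gamma>) (F k y)"
  obtains u h where "u \<in> carrier (profinite_group H)" "h \<in> iso G H"
    "\<And>x. x \<in> carrier (profinite_group G) \<Longrightarrow>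
       Inn (profinite_group H) (inv\<^bsub>profinite_group H\<^esub> u) (\<eta> x) = profinite_map G H h x"
    "\<And>k. F k ` A.original k = B.mv u ` B.original k"
proof -
  let ?P = "profinite_group G" and ?Q = "profinite_group H"
  interpret P: group ?P by (rule A.group_profinite)
  interpret Q: group ?Q by (rule B.group_profinite)
  have \<eta>_hom: "\<eta> \<in> hom ?P ?Q" and \<eta>_bij: "bij_betw \<eta> (carrier ?P) (carrier ?Q)"
    using \<eta> by (auto simp: iso_def)
  interpret \<eta>: group_hom ?P ?Q \<eta> using \<eta>_hom by unfold_locales
  have \<eta>_surj: "\<exists>x\<in>carrier ?P. \<eta> x = y" if "y \<in> carrier ?Q" for y
    using \<eta>_bij that by (metis bij_betw_def imageE)
  have F_inj: "x = y" if "F k x = F k y" "x \<in> A.space k" "y \<in> A.space k" for k x y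
    using F_bij[of k] that by (auto simp: bij_betw_def inj_on_def)
  have ptA: "A.pt z \<in> A.space k" if "z \<in> cubical_set C k" for z k
    using that by (rule A.space_point)
  have ptB: "B.pt z \<in> B.space k" if "z \<in> cubical_set D k" for z k
    using that by (rule B.space_point)
  obtain v where v: "v \<in> verts C" using A.verts_nonempty connected by blast
  define x where "x = Vert v"
  have x: "x \<in> cubical_set C C0" using v by (simp add: x_def)
  \<comment> \<open>The origin of \<open>u\<close>: the image of one original vertex is a translate
    of an original vertex.\<close>
  obtain u w where u: "u \<in> carrier ?Q" and w: "w \<in> cubical_set D C0"
    and Fx: "F C0 (A.pt x) = B.mv u (B.pt w)"
    using B.space_eq_move_point[OF F_closed[OF ptA[OF x]]] by blast
  obtain w0 where w0: "w0 \<in> verts D" "w = Vert w0" using w by auto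
  have into: "F k ` A.original k \<subseteq> B.mv u ` B.original k" for k
    using F_original[OF connected(1) u v] Fx w by (auto simp: B.original_eq x_def)
  \<comment> \<open>Let \<open>u'\<close> be the preimage of \<open>u^-1\<close> under \<eta>. By
    equivariance the inverse of \<open>F\<close> sends \<open>w\<close> to \<open>u' x\<close>, so
    it maps original points into the translate by \<open>u'\<close>; applying \<open>F\<close> turns
    \<open>u'\<close> into \<open>u^-1\<close>, which cancels against \<open>u\<close>.\<close>
  have onto: "B.mv u ` B.original k \<subseteq> F k ` A.original k" for k
  proof -
    obtain u' where u': "u' \<in> carrier ?P" "\<eta> u' = inv\<^bsub>?Q\<^esub> u"
      using \<eta>_surj Q.inv_closed[OF u] by blast
    have move_back: "B.mv (inv\<^bsub>?Q\<^esub> u) (B.mv u y) = y" if "y \<in> B.space k" for y k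
      using u that by (simp flip: B.space_move_mult add: B.space_move_one)
    interpret I: residual_map H D \<psi> \<M> G C \<phi> \<N> "\<lambda>k. inv_into (A.space k) (F k)"
      by (rule F_inverse)
    have inv_eq: "inv_into (A.space k) (F k) (F k y) = y" if "y \<in> A.space k" for k y
      using F_bij[of k] that by (auto simp: bij_betw_def)
    have "F C0 (A.mv u' (A.pt x)) = B.pt w"
      using equivariant[OF u'(1) ptA[OF x]] u'(2) Fx move_back ptB[OF w] by simp
    then have "inv_into (A.space C0) (F C0) (B.pt w) = A.mv u' (A.pt x)"
      using inv_eq[OF A.space_move[OF u'(1) ptA[OF x]]] by simp
    then have sub: "inv_into (A.space k) (F k) ` B.original k \<subseteq> A.mv u' ` A.original k"
      using I.F_original[OF connected(2) u'(1) w0(1)] x w0(2) by (auto simp: A.original_eq)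
    show ?thesis
    proof
      fix y assume "y \<in> B.mv u ` B.original k"
      then obtain s where s: "s \<in> cubical_set D k" "y = B.mv u (B.pt s)" by (auto simp: B.original_eq)
      then obtain z where z: "z \<in> cubical_set C k"
        "inv_into (A.space k) (F k) (B.pt s) = A.mv u' (A.pt z)"
        using sub by (auto simp: A.original_eq B.original_eq)
      have "B.pt s = F k (inv_into (A.space k) (F k) (B.pt s))"
        using F_bij[of k] ptB[OF s(1)] by (simp add: bij_betw_def f_inv_into_f)
      then have "B.pt s = B.mv (inv\<^bsub>?Q\<^esub> u) (F k (A.pt z))"
        using z(2) equivariant[OF u'(1) ptA[OF z(1)]] u'(2) by simp
      then have "y = F k (A.pt z)"
        using s(2) u F_closed[OF ptA[OF z(1)]]
        by (simp flip: B.space_move_mult add: B.space_move_one)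
      then show "y \<in> F k ` A.original k" using z(1) by (auto simp: A.original_eq)
    qed
  qed
  have F_orig: "F k ` A.original k = B.mv u ` B.original k" for k
    using into onto by (rule equalityI)
  define \<theta> where "\<theta> = Inn ?Q (inv\<^bsub>?Q\<^esub> u) \<circ> \<eta>"
  have \<theta>_eq: "\<theta> y = inv\<^bsub>?Q\<^esub> u \<otimes>\<^bsub>?Q\<^esub> \<eta> y \<otimes>\<^bsub>?Q\<^esub> u" for y
    using u by (simp add: \<theta>_def Inn_def)
  have \<theta>_mult: "\<theta> (y \<otimes>\<^bsub>?P\<^esub> z) = \<theta> y \<otimes>\<^bsub>?Q\<^esub> \<theta> z" if "y \<in> carrier ?P" "z \<in> carrier ?P" for y z
  proof -
    have "u \<otimes>\<^bsub>?Q\<^esub> (inv\<^bsub>?Q\<^esub> u \<otimes>\<^bsub>?Q\<^esub> (\<eta> z \<otimes>\<^bsub>?Q\<^esub> u)) = \<eta> z \<otimes>\<^bsub>?Q\<^esub> u"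
      using that u by (simp flip: Q.m_assoc)
    then show ?thesis using that u by (simp add: \<theta>_eq Q.m_assoc)
  qed
  have \<theta>_inj: "y = z" if "\<theta> y = \<theta> z" "y \<in> carrier ?P" "z \<in> carrier ?P" for y z
  proof -
    have "\<eta> y = \<eta> z" using that u by (simp add: \<theta>_eq)
    then show ?thesis using \<eta>_bij that by (auto simp: bij_betw_def inj_on_def)
  qed
  \<comment> \<open>Discreteness can now be tested on the orbit of \<open>x\<close>: if the image of
    \<open>\<gamma> x\<close> lies in the translate by \<open>u\<close>, then
    \<open>move_point_eqD\<close> yields \<open>\<eta> \<gamma> u = u g'\<close> with
    \<open>g'\<close> discrete, that is, \<open>\<theta> \<gamma> = g'\<close>.\<close>
  have F_move: "F C0 (A.mv \<gamma> (A.pt x)) = B.mv (\<eta> \<gamma> \<otimes>\<^bsub>?Q\<^esub> u) (B.pt w)" if "\<gamma> \<in> carrier ?P" for \<gamma>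
    using equivariant[OF that ptA[OF x]] Fx that u ptB[OF w] by (simp add: B.space_move_mult)
  have "\<exists>g'\<in>carrier H. \<theta> (A.profinite_embed g) = B.profinite_embed g'" if g: "g \<in> carrier G" for g
  proof -
    let ?\<gamma> = "A.profinite_embed g"
    have \<gamma>: "?\<gamma> \<in> carrier ?P" using g by (rule A.profinite_embed_closed)
    have "A.mv ?\<gamma> (A.pt x) \<in> A.original C0"
      using free_set_action.move_embed[OF A.free_set g x] A.cubical_act_closed[OF g x]
      by (simp add: A.original_eq)
    then have "B.mv (\<eta> ?\<gamma> \<otimes>\<^bsub>?Q\<^esub> u) (B.pt w) \<in> B.mv u ` B.original C0"
      unfolding F_move[OF \<gamma>, symmetric] using into[of C0] by blast
    then obtain s where s: "s \<in> cubical_set D C0"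
      "B.mv (\<eta> ?\<gamma> \<otimes>\<^bsub>?Q\<^esub> u) (B.pt w) = B.mv u (B.pt s)"
      unfolding B.original_eq by blast
    obtain g' where g': "g' \<in> carrier H"
      "\<eta> ?\<gamma> \<otimes>\<^bsub>?Q\<^esub> u = u \<otimes>\<^bsub>?Q\<^esub> B.profinite_embed g'"
      using free_set_action.move_point_eqD[OF B.free_set _ u w s(1) s(2)] \<gamma> u by auto
    have "\<theta> ?\<gamma> = inv\<^bsub>?Q\<^esub> u \<otimes>\<^bsub>?Q\<^esub> (u \<otimes>\<^bsub>?Q\<^esub> B.profinite_embed g')"
      using \<gamma> u by (simp add: \<theta>_eq Q.m_assoc flip: g'(2))
    then show ?thesis
      using g'(1) u B.profinite_embed_closed[OF g'(1)] by (auto simp flip: Q.m_assoc)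
  qed
  then obtain h where h: "\<And>g. g \<in> carrier G \<Longrightarrow> h g \<in> carrier H"
    and \<theta>h: "\<And>g. g \<in> carrier G \<Longrightarrow> \<theta> (A.profinite_embed g) = B.profinite_embed (h g)"
    by metis
  note injA = inj_onD[OF A.profinite_embed_inj[OF rf(1)]]
    and injB = inj_onD[OF B.profinite_embed_inj[OF rf(2)]]
  have h_hom: "h \<in> hom G H"
  proof (rule homI)
    fix a b assume ab: "a \<in> carrier G" "b \<in> carrier G"
    have "B.profinite_embed (h (a \<otimes>\<^bsub>G\<^esub> b)) = \<theta> (A.profinite_embed a \<otimes>\<^bsub>?P\<^esub> A.profinite_embed b)"
      using \<theta>h ab by (simp flip: A.profinite_embed_mult)
    also have "\<dots> = B.profinite_embed (h a \<otimes>\<^bsub>H\<^esub> h b)"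
      using \<theta>h ab h by (simp add: \<theta>_mult A.profinite_embed_closed B.profinite_embed_mult)
    finally show "h (a \<otimes>\<^bsub>G\<^esub> b) = h a \<otimes>\<^bsub>H\<^esub> h b"
      by (rule injB) (use ab h in auto)
  qed (use h in auto)
  have h_inj: "inj_on h (carrier G)"
  proof (rule inj_onI)
    fix a b assume ab: "a \<in> carrier G" "b \<in> carrier G" "h a = h b"
    have "A.profinite_embed a = A.profinite_embed b"
      by (rule \<theta>_inj) (use \<theta>h ab A.profinite_embed_closed in auto)
    then show "a = b" using injA ab by blast
  qed
  \<comment> \<open>Take \<open>\<delta>\<close> with \<open>\<theta> \<delta> = g\<close>. Then
    \<open>F\<close> sends \<open>\<delta> x\<close> to \<open>u (g w)\<close>, which by
    \<open>onto\<close> is also the image of an original point \<open>z\<close>. Injectivity of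
    \<open>F\<close> gives \<open>\<delta> x = z\<close>, and freeness makes \<open>\<delta>\<close>
    discrete.\<close>
  have h_surj: "g \<in> h ` carrier G" if g: "g \<in> carrier H" for g
  proof -
    let ?g = "B.profinite_embed g"
    have gQ: "?g \<in> carrier ?Q" using g by (rule B.profinite_embed_closed)
    obtain \<delta> where \<delta>: "\<delta> \<in> carrier ?P" "\<eta> \<delta> = u \<otimes>\<^bsub>?Q\<^esub> ?g \<otimes>\<^bsub>?Q\<^esub> inv\<^bsub>?Q\<^esub> u"
      using \<eta>_surj u gQ by (meson Q.inv_closed Q.m_closed)
    have "\<eta> \<delta> \<otimes>\<^bsub>?Q\<^esub> u = u \<otimes>\<^bsub>?Q\<^esub> ?g" using \<delta>(2) u gQ by (simp add: Q.m_assoc)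
    then have "F C0 (A.mv \<delta> (A.pt x)) = B.mv u (B.pt (cubical_act D \<psi> g w))"
      using F_move[OF \<delta>(1)] u gQ ptB[OF w] free_set_action.move_embed[OF B.free_set g w]
      by (simp add: B.space_move_mult)
    also have "\<dots> \<in> F C0 ` A.original C0"
      using onto[of C0] B.cubical_act_closed[OF g w] by (auto simp: B.original_eq)
    finally obtain z where z: "z \<in> cubical_set C C0" "F C0 (A.mv \<delta> (A.pt x)) = F C0 (A.pt z)"
      by (auto simp: A.original_eq)
    \<comment> \<open>The trivial translation is inserted to give \<open>z\<close> the shape
      required by \<open>move_point_eqD\<close>.\<close>
    then have "A.mv \<delta> (A.pt x) = A.mv \<one>\<^bsub>?P\<^esub> (A.pt z)"
      using F_inj A.space_move[OF \<delta>(1) ptA[OF x]] ptA[OF z(1)] by (simp add: A.space_move_one)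
    then obtain a where a: "a \<in> carrier G" "\<delta> = \<one>\<^bsub>?P\<^esub> \<otimes>\<^bsub>?P\<^esub> A.profinite_embed a"
      using free_set_action.move_point_eqD[OF A.free_set \<delta>(1) P.one_closed x z(1)] by blast
    then have da: "\<delta> = A.profinite_embed a" by (simp add: A.profinite_embed_closed)
    have "B.profinite_embed (h a) = \<theta> \<delta>" using \<theta>h a da by simp
    also have "\<dots> = inv\<^bsub>?Q\<^esub> u \<otimes>\<^bsub>?Q\<^esub> (u \<otimes>\<^bsub>?Q\<^esub> ?g)"
      using \<open>\<eta> \<delta> \<otimes>\<^bsub>?Q\<^esub> u = u \<otimes>\<^bsub>?Q\<^esub> ?g\<close> \<delta>(1) u by (simp add: \<theta>_eq Q.m_assoc)
    also have "\<dots> = ?g" using u gQ by (simp flip: Q.m_assoc)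
    finally have "h a = g" by (rule injB) (use h a g in auto)
    then show ?thesis using a by blast
  qed
  have h_iso: "h \<in> iso G H"
    using h_hom h_inj h_surj h by (auto simp: iso_def bij_betw_def)
  have "continuous_map (profinite_top G) (profinite_top H) \<theta>"
    unfolding \<theta>_def
    by (rule continuous_map_compose[OF cont B.Inn_continuous[OF Q.inv_closed[OF u]]])
  then have "\<theta> y = profinite_map G H h y" if "y \<in> carrier ?P" for y
    using A.profinite_map_unique[OF B.is_group h_hom _ \<theta>h that] by blast
  then show ?thesis using that[OF u h_iso] F_orig by (simp add: \<theta>_def)
qed

end

theorem theorem5p11:
  fixes \<Gamma>1 :: "'g monoid" and \<Gamma>2 :: "'h monoid"
    and X1 :: "'p square_complex" and X2 :: "'q square_complex"
    and \<phi>1 :: "'g \<Rightarrow> 'p \<Rightarrow> 'p" and \<phi>2 :: "'h \<Rightarrow> 'q \<Rightarrow> 'q"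
    and \<N>1 :: "'g set set" and \<N>2 :: "'h set set"
    and \<eta> :: "('g set \<Rightarrow> 'g set) \<Rightarrow> ('h set \<Rightarrow> 'h set)"
    and F :: "rsort \<Rightarrow> ('g set \<Rightarrow> 'p relt set) \<Rightarrow> ('h set \<Rightarrow> 'q relt set)"
  defines "act1 \<equiv> completion_act \<N>1 (cubical_act X1 \<phi>1)"
    and "act2 \<equiv> completion_act \<N>2 (cubical_act X2 \<phi>2)"
    and "orig1 \<equiv> original_points \<Gamma>1 \<N>1 X1 \<phi>1"
    and "orig2 \<equiv> original_points \<Gamma>2 \<N>2 X2 \<phi>2"
    and "P1 \<equiv> profinite_group \<Gamma>1"
    and "P2 \<equiv> profinite_group \<Gamma>2"
    and "hX1 \<equiv> completed_residual_complex \<Gamma>1 \<N>1 X1 \<phi>1"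
    and "hX2 \<equiv> completed_residual_complex \<Gamma>2 \<N>2 X2 \<phi>2"
  assumes "group \<Gamma>1" "finitely_generated \<Gamma>1" "residually_finite \<Gamma>1"
    and "group \<Gamma>2" "finitely_generated \<Gamma>2" "residually_finite \<Gamma>2"
    and "regular_square_complex X1" "connected_complex X1" "locally_finite_complex X1"
    and "regular_square_complex X2" "connected_complex X2" "locally_finite_complex X2"
    and "cellular_action \<Gamma>1 X1 \<phi>1" "free_action \<Gamma>1 X1 \<phi>1" "cocompact_action \<Gamma>1 X1 \<phi>1"
    and "cellular_action \<Gamma>2 X2 \<phi>2" "free_action \<Gamma>2 X2 \<phi>2" "cocompact_action \<Gamma>2 X2 \<phi>2"
    and "cofinal_family \<Gamma>1 \<N>1" "cofinal_family \<Gamma>2 \<N>2"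
    and "\<eta> \<in> iso P1 P2" "continuous_map (profinite_top \<Gamma>1) (profinite_top \<Gamma>2) \<eta>"
    and "residual_isomorphism hX1 hX2 F"
    and "\<forall>k. \<forall>\<gamma>\<in>carrier P1. \<forall>y\<in>topspace (component hX1 k). F k (act1 \<gamma> y) = act2 (\<eta> \<gamma>) (F k y)"
  shows "(\<exists>u\<in>carrier P2. \<exists>h\<in>iso \<Gamma>1 \<Gamma>2.
            (\<forall>x\<in>carrier P1. \<eta> x = Inn P2 u (profinite_map \<Gamma>1 \<Gamma>2 h x)) \<and>
            (\<forall>k. F k ` orig1 k = act2 u ` orig2 k) \<and>
            (\<forall>x\<in>carrier P1. Inn P2 (inv\<^bsub>P2\<^esub> u) (\<eta> x) = profinite_map \<Gamma>1 \<Gamma>2 h x) \<and>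
            (\<forall>k. (\<lambda>y. act2 (inv\<^bsub>P2\<^esub> u) (F k y)) ` orig1 k = orig2 k))
         \<and> discretely_induced_up_to_inner \<Gamma>1 \<Gamma>2 \<eta>"
proof -
  have A: "completed_action \<Gamma>1 X1 \<phi>1 \<N>1" and B: "completed_action \<Gamma>2 X2 \<phi>2 \<N>2"
    using assms(9-)
    by (auto intro!: completed_action.intro complex_action.intro complex_action_axioms.intro
        cofinal_group.intro cofinal_group_axioms.intro regular_complex.intro)
  interpret residual_map \<Gamma>1 X1 \<phi>1 \<N>1 \<Gamma>2 X2 \<phi>2 \<N>2 F
    by (intro residual_map.intro residual_map_axioms.intro A B)
      (use assms in \<open>simp only: hX1_def hX2_def\<close>)
  interpret P2: group P2 unfolding P2_def by (rule B.group_profinite)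
  have equivariant: "F k (act1 \<gamma> y) = act2 (\<eta> \<gamma>) (F k y)"
    if "\<gamma> \<in> carrier P1" "y \<in> A.space k" for k \<gamma> y
    using assms(32) that unfolding hX1_def by blast
  \<comment> \<open>\<open>rigidity\<close> gives the normalized identity for \<eta> and the
    unnormalized one for \<open>F\<close>; the other two forms follow by cancelling
    \<open>u\<close>.\<close>
  obtain u h where u: "u \<in> carrier P2" and h: "h \<in> iso \<Gamma>1 \<Gamma>2"
    and norm: "\<And>x. x \<in> carrier P1 \<Longrightarrow> Inn P2 (inv\<^bsub>P2\<^esub> u) (\<eta> x) = profinite_map \<Gamma>1 \<Gamma>2 h x"
    and F: "\<And>k. F k ` orig1 k = act2 u ` orig2 k"
    using rigidity[of \<eta>] assms(9-31) equivariant
    unfolding act1_def act2_def orig1_def orig2_def P1_def P2_def by metis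
  have \<eta>: "\<eta> x = Inn P2 u (profinite_map \<Gamma>1 \<Gamma>2 h x)" if x: "x \<in> carrier P1" for x
  proof -
    have "\<eta> x \<in> carrier P2" using \<open>\<eta> \<in> iso P1 P2\<close> x by (auto simp: iso_def hom_def)
    moreover from this have "u \<otimes>\<^bsub>P2\<^esub> (inv\<^bsub>P2\<^esub> u \<otimes>\<^bsub>P2\<^esub> \<eta> x) = \<eta> x"
      using u by (simp flip: P2.m_assoc)
    ultimately show ?thesis
      using u by (simp add: norm[OF x, symmetric] Inn_def P2.m_assoc)
  qed
  have "(\<lambda>y. act2 (inv\<^bsub>P2\<^esub> u) (F k y)) ` orig1 k = orig2 k" for k
  proof -
    have move_back: "act2 (inv\<^bsub>P2\<^esub> u) (act2 u y) = y" if "y \<in> orig2 k" for y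
    proof -
      have y: "y \<in> B.space k" using that B.space_point by (auto simp: orig2_def B.original_eq)
      have "act2 (inv\<^bsub>P2\<^esub> u) (act2 u y) = act2 (inv\<^bsub>P2\<^esub> u \<otimes>\<^bsub>P2\<^esub> u) y"
        using B.space_move_mult[OF _ _ y] u P2.inv_closed[OF u] unfolding act2_def P2_def by simp
      then show ?thesis
        using B.space_move_one[OF y] u unfolding act2_def by (simp add: P2_def[symmetric])
    qed
    have "(\<lambda>y. act2 (inv\<^bsub>P2\<^esub> u) (F k y)) ` orig1 k = act2 (inv\<^bsub>P2\<^esub> u) ` act2 u ` orig2 k"
      by (simp only: F[symmetric] image_image)
    then show ?thesis using move_back by (simp add: image_image)
  qed
  then show ?thesis
    using u h norm \<eta> F unfolding discretely_induced_up_to_inner_def P1_def P2_def by blast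
qed

end
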